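(* Let $n\ge 2$, let $D$ be a domain in $\mathbb{R}^n$, let $k$ be an integer with $1\le k\le n-1$, and let $p\ge k$ be real. Let $f:D\to\mathbb{R}^n$ be a continuous, orientation preserving mapping of finite metric distortion which has the $(A^{(1,p)}_k)$-property, and let $E\subset D$ be a Borel set. Then $$M_p(\Gamma)\ \le\ \int_{f(E)}K_{I,p}(y,f^{-1},E)\,\rho_*^p(y)\,dm(y)$$ for every family $\Gamma$ of $k$-dimensional surfaces $S$ in $E$ and every $\rho_*\in\mathrm{adm}\,f(\Gamma)$, where $f(\Gamma)=\{f\circ S: S\in\Gamma\}$, $dm(y)$ denotes integration with respect to Lebesgue measure on $\mathbb{R}^n$, and $$K_{I,p}(y,f^{-1},E)=\sum_{x\in E\cap f^{-1}(y)}K_{O,p}(x,f).$$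
   Context: **Surfaces and area.** Let $\overline{\mathbb{R}^k}=\mathbb{R}^k\cup\{\infty\}$. A $k$-dimensional surface $S$ in a set $A\subset\mathbb{R}^n$ ($1\le k\le n-1$) is a continuous mapping $S:\omega\to A$, where $\omega$ is an open set in $\overline{\mathbb{R}^k}$; the image $S(\omega)$ is sometimes also denoted by $S$. Its multiplicity function is $N(S,y)=\mathrm{card}\,S^{-1}(y)$, $y\in\mathbb{R}^n$. With $\mathcal{H}^k$ the $k$-dimensional Hausdorff measure, the area of an $\mathcal H^k$-measurable set $B\subset\mathbb{R}^n$ associated with $S$ is $\mathcal{A}_S(B)=\int_B N(S,y)\,d\mathcal{H}^k y$. For a Borel function $\rho:\mathbb{R}^n\to[0,\infty]$ set $\int_S\rho\,d\mathcal{A}:=\int_{\mathbb{R}^n}\rho(y)N(S,y)\,d\mathcal{H}^k y$. **Modulus.** For a family $\Gamma$ of $k$-dimensional surfaces in $\mathbb{R}^n$, a Borel function $\rho:\mathbb{R}^n\to[0,\infty]$ is admissible for $\Gamma$, written $\rho\in\mathrm{adm}\,\Gamma$, if $\int_S\rho^k\,d\mathcal{A}\ge 1$ for every $S\in\Gamma$. For $p\ge1$, the $p$-modulus is $M_p(\Gamma)=\inf_{\rho\in\mathrm{adm}\,\Gamma}\int_{\mathbb{R}^n}\rho^p(x)\,dm(x)$. A property holds for $p$-a.e. $k$-dimensional surface if it holds for all of them except for a family of zero $p$-modulus. **Finite metric distortion.** For $x\in D$ put $L(x,f)=\limsup_{y\to x}\frac{|f(x)-f(y)|}{|x-y|}$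 and $l(x,f)=\liminf_{y\to x}\frac{|f(x)-f(y)|}{|x-y|}$ ($y\in D$). The mapping $f$ is of finite metric distortion if it has the Luzin $N$-property (it maps Lebesgue null sets to Lebesgue null sets) and $0<l(x,f)\le L(x,f)<\infty$ for almost all $x\in D$. **$(A^{(1,p)}_k)$-property.** The mapping $f$ has the $(A^{(1,p)}_k)$-property if for $p$-a.e. $k$-dimensional surface $S$ in $D$ the restriction $f|_S$ has the $N$-property with respect to area: for every subset $B$ of the image of $S$, $\mathcal{A}_S(B)=0$ implies $\mathcal{A}_{f\circ S}(f(B))=0$ (equivalently, $\mathcal{H}^k(B)=0$ implies $\mathcal{H}^k(f(B))=0$). **Orientation preserving.** $f$ is orientation preserving if the topological index (topological degree) satisfies $\mu(y,f,G)>0$ for every domain $G$ with compact closure $\overline{G}\subset D$ and every $y\in f(G)\setminus f(\partial G)$. **Outer dilatation.** At points $x$ of differentiability of $f$ put $\|f'(x)\|=\max_{h\ne0}|f'(x)h|/|h|$ and $J(x,f)=\det f'(x)$. Then $K_{O,p}(x,f)=\|f'(x)\|^p/|J(x,f)|$ if $J(x,f)\ne0$; $K_{O,p}(x,f)=1$ if $f'(x)=0$; and $K_{O,p}(x,f)=\infty$ otherwise. *)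

theory Defs
  imports "HOL-Analysis.Analysis"
begin

subsection \<open>Hausdorff measure\<close>

text \<open>
  The usual normalisation: a set of diameter \<open>d\<close> contributes
  \<open>\<Omega>\<^sub>k (d/2)^k\<close>, where \<open>\<Omega>\<^sub>k\<close> is the volume of the unit ball of
  dimension \<open>k\<close>. The library's \<^const>\<open>diameter\<close> has no meaning on unbounded sets, hence
  the explicit boundedness. The dimension is meant to be positive: for \<open>k = 0\<close> the empty
  members of a cover would be counted with weight \<open>1\<close>.
\<close>

definition hausdorff_content :: "nat \<Rightarrow> real \<Rightarrow> 'a::metric_space set \<Rightarrow> ennreal" where
  "hausdorff_content k \<delta> A =
     (INF C \<in> {C :: nat \<Rightarrow> 'a set. A \<subseteq> (\<Union>i. C i) \<and> (\<forall>i. bounded (C i) \<and> diameter (C i) < \<delta>)}.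
        \<Sum>i. ennreal (unit_ball_vol (real k) * (diameter (C i) / 2) ^ k))"

definition hausdorff_outer :: "nat \<Rightarrow> 'a::metric_space set \<Rightarrow> ennreal" where
  "hausdorff_outer k A = (SUP \<delta> \<in> {0<..}. hausdorff_content k \<delta> A)"

text \<open>The measurable sets are the Caratheodory measurable ones.\<close>

definition hausdorff_measure :: "nat \<Rightarrow> 'a::metric_space measure" where
  "hausdorff_measure k =
     measure_of UNIV (lambda_system UNIV (Pow UNIV) (hausdorff_outer k)) (hausdorff_outer k)"

lemma hausdorff_content_le:
  assumes "A \<subseteq> (\<Union>i. C i)" "\<And>i. bounded (C i)" "\<And>i. diameter (C i) < \<delta>"
  shows "hausdorff_content k \<delta> A
           \<le> (\<Sum>i. ennreal (unit_ball_vol (real k) * (diameter (C i) / 2) ^ k))"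
  unfolding hausdorff_content_def using assms by (intro INF_lower) auto

lemma hausdorff_content_mono:
  assumes "A \<subseteq> B"
  shows "hausdorff_content k \<delta> A \<le> hausdorff_content k \<delta> B"
  unfolding hausdorff_content_def using assms by (intro INF_superset_mono) auto

lemma hausdorff_content_UN_le:
  fixes A :: "nat \<Rightarrow> 'a::metric_space set"
  shows "hausdorff_content k \<delta> (\<Union>i. A i) \<le> (\<Sum>i. hausdorff_content k \<delta> (A i))"
proof (rule ennreal_le_epsilon)
  fix e :: real
  assume e: "0 < e" and fin: "(\<Sum>i. hausdorff_content k \<delta> (A i)) < top"
  let ?w = "\<lambda>C. ennreal (unit_ball_vol (real k) * (diameter (C::'a set) / 2) ^ k)"
  have fin_i: "hausdorff_content k \<delta> (A i) < top" for i
  proof -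
    have "hausdorff_content k \<delta> (A i) \<le> (\<Sum>i. hausdorff_content k \<delta> (A i))"
      using sum_le_suminf[of "\<lambda>i. hausdorff_content k \<delta> (A i)" "{i}"] by simp
    then show ?thesis using fin by (rule le_less_trans)
  qed
  have "\<exists>C. A i \<subseteq> (\<Union>j. C j) \<and> (\<forall>j. bounded (C j) \<and> diameter (C j) < \<delta>) \<and>
          (\<Sum>j. ?w (C j)) < hausdorff_content k \<delta> (A i) + ennreal (e * (1/2) ^ Suc i)" for i
  proof -
    have "hausdorff_content k \<delta> (A i) < hausdorff_content k \<delta> (A i) + ennreal (e * (1/2) ^ Suc i)"
      using e fin_i[of i] by (cases "hausdorff_content k \<delta> (A i)")
        (simp_all add: ennreal_plus[symmetric] ennreal_less_iff del: ennreal_plus power_Suc)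
    then show ?thesis
      unfolding hausdorff_content_def[of k \<delta> "A i"] INF_less_iff by auto
  qed
  then obtain C where C: "\<And>i. A i \<subseteq> (\<Union>j. C i j)" "\<And>i j. bounded (C i j)" "\<And>i j. diameter (C i j) < \<delta>"
      "\<And>i. (\<Sum>j. ?w (C i j)) < hausdorff_content k \<delta> (A i) + ennreal (e * (1/2) ^ Suc i)"
    by metis
  let ?D = "\<lambda>n. case prod_decode n of (i, j) \<Rightarrow> C i j"
  have "(\<Union>i. A i) \<subseteq> (\<Union>n. ?D n)"
  proof
    fix x assume "x \<in> (\<Union>i. A i)"
    then obtain i j where "x \<in> C i j" using C(1) by blast
    then have "x \<in> ?D (prod_encode (i, j))" by simp
    then show "x \<in> (\<Union>n. ?D n)" by (rule UN_I[OF UNIV_I])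
  qed
  then have "hausdorff_content k \<delta> (\<Union>i. A i) \<le> (\<Sum>n. ?w (?D n))"
    by (intro hausdorff_content_le) (auto split: prod.split simp: C(2,3))
  also have "\<dots> = (\<Sum>i. \<Sum>j. ?w (C i j))"
  proof -
    have "(\<Sum>n. (\<lambda>(i, j). ?w (C i j)) (prod_decode n)) = (\<Sum>i. \<Sum>j. ?w (C i j))"
      using suminf_ennreal_2dimen[of "\<lambda>i. \<Sum>j. ?w (C i j)" "\<lambda>(i, j). ?w (C i j)"]
      by (simp add: comp_def)
    then show ?thesis by (simp add: case_prod_unfold)
  qed
  also have "\<dots> \<le> (\<Sum>i. hausdorff_content k \<delta> (A i) + ennreal (e * (1/2) ^ Suc i))"
    using C(4) by (intro suminf_le) (auto intro: less_imp_le)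
  also have "\<dots> = (\<Sum>i. hausdorff_content k \<delta> (A i)) + (\<Sum>i. ennreal (e * (1/2) ^ Suc i))"
    by (intro suminf_add[symmetric]) auto
  also have "(\<Sum>i. ennreal (e * (1/2) ^ Suc i)) = ennreal e"
    using e sums_mult[OF power_half_series, of e]
    by (intro suminf_ennreal_eq) auto
  finally show "hausdorff_content k \<delta> (\<Union>i. A i) \<le> (\<Sum>i. hausdorff_content k \<delta> (A i)) + ennreal e" .
qed

lemma outer_measure_space_hausdorff:
  assumes "k \<ge> 1"
  shows "outer_measure_space (Pow UNIV) (hausdorff_outer k :: 'a::metric_space set \<Rightarrow> ennreal)"
proof -
  have "hausdorff_outer k ({} :: 'a set) = 0"
  proof -
    have "hausdorff_content k \<delta> ({} :: 'a set) = 0" if "\<delta> > 0" for \<delta>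
      using hausdorff_content_le[of "{}" "\<lambda>_. {} :: 'a set" \<delta> k] that assms
      by (simp add: power_0_left)
    then show ?thesis unfolding hausdorff_outer_def by simp
  qed
  moreover have "hausdorff_outer k A \<le> hausdorff_outer k B" if "A \<subseteq> B" for A B :: "'a set"
    unfolding hausdorff_outer_def using that by (intro SUP_mono) (auto intro: hausdorff_content_mono)
  moreover have "hausdorff_outer k (\<Union>i. A i) \<le> (\<Sum>i. hausdorff_outer k (A i))"
    for A :: "nat \<Rightarrow> 'a set"
    unfolding hausdorff_outer_def[of k "\<Union>i. A i"]
  proof (intro SUP_least)
    fix \<delta> :: real assume "\<delta> \<in> {0<..}"
    then have "(\<Sum>i. hausdorff_content k \<delta> (A i)) \<le> (\<Sum>i. hausdorff_outer k (A i))"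
      unfolding hausdorff_outer_def by (intro suminf_le SUP_upper) auto
    then show "hausdorff_content k \<delta> (\<Union>i. A i) \<le> (\<Sum>i. hausdorff_outer k (A i))"
      using hausdorff_content_UN_le order_trans by blast
  qed
  ultimately show ?thesis
    by (simp add: outer_measure_space_def positive_def increasing_def countably_subadditive_def)
qed

lemma
  assumes "k \<ge> 1"
  shows space_hausdorff_measure: "space (hausdorff_measure k :: 'a::metric_space measure) = UNIV"
    and sets_hausdorff_measure: "sets (hausdorff_measure k :: 'a measure) =
           lambda_system UNIV (Pow UNIV) (hausdorff_outer k)"
    and emeasure_hausdorff_measure: "A \<in> sets (hausdorff_measure k :: 'a measure) \<Longrightarrow>
           emeasure (hausdorff_measure k) A = hausdorff_outer k A"
proof -
  let ?L = "lambda_system UNIV (Pow UNIV) (hausdorff_outer k) :: 'a set set"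
  have "measure_space UNIV ?L (hausdorff_outer k)"
    using sigma_algebra.caratheodory_lemma[OF sigma_algebra_Pow outer_measure_space_hausdorff[OF assms]] .
  then have L: "sigma_algebra UNIV ?L" "positive ?L (hausdorff_outer k)"
      "countably_additive ?L (hausdorff_outer k)"
    by (auto simp: measure_space_def)
  show "space (hausdorff_measure k :: 'a measure) = UNIV"
    unfolding hausdorff_measure_def by (simp add: space_measure_of_conv)
  show sets: "sets (hausdorff_measure k :: 'a measure) = ?L"
    unfolding hausdorff_measure_def using sigma_algebra.sets_measure_of_eq[OF L(1)] .
  show "emeasure (hausdorff_measure k) A = hausdorff_outer k A"
    if "A \<in> sets (hausdorff_measure k :: 'a measure)"
    using that L unfolding sets
    by (simp add: hausdorff_measure_def emeasure_measure_of_sigma)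
qed

subsection \<open>Surfaces and modulus\<close>

text \<open>
  A surface is a pair of its parameter set, an open subset of the one-point compactification
  of \<open>\<real>^k\<close> (\<^const>\<open>None\<close> is the point at infinity), and a map, of which only the values on
  the parameter set matter. The dimension \<open>k\<close> is \<open>CARD('k)\<close>.
\<close>

type_synonym ('k, 'n) surface = "(real^'k) option set \<times> ((real^'k) option \<Rightarrow> real^'n)"

definition surfaces_in :: "(real^'n) set \<Rightarrow> ('k::finite, 'n::finite) surface set" where
  "surfaces_in A = {(\<omega>, S). openin (Alexandroff_compactification euclidean) \<omega> \<and>
     continuous_map (subtopology (Alexandroff_compactification euclidean) \<omega>) (top_of_set A) S}"

definition surface_image :: "('k::finite, 'n::finite) surface \<Rightarrow> (real^'n) set" where
  "surface_image S = snd S ` fst S"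

definition surface_comp :: "(real^'n \<Rightarrow> real^'m) \<Rightarrow> ('k::finite, 'n::finite) surface \<Rightarrow> ('k, 'm::finite) surface" where
  "surface_comp f S = (fst S, f \<circ> snd S)"

text \<open>Multiplicity, with value \<open>\<infinity>\<close> where the preimage is infinite.\<close>

definition multiplicity_fun :: "('k::finite, 'n::finite) surface \<Rightarrow> real^'n \<Rightarrow> ennreal" where
  "multiplicity_fun S y = emeasure (count_space UNIV) {u \<in> fst S. snd S u = y}"

definition surface_area :: "('k::finite, 'n::finite) surface \<Rightarrow> (real^'n) set \<Rightarrow> ennreal" where
  "surface_area S B = (\<integral>\<^sup>+ y\<in>B. multiplicity_fun S y \<partial>hausdorff_measure CARD('k))"

definition surface_integral :: "('k::finite, 'n::finite) surface \<Rightarrow> (real^'n \<Rightarrow> ennreal) \<Rightarrow> ennreal" where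
  "surface_integral S \<rho> = (\<integral>\<^sup>+ y. \<rho> y * multiplicity_fun S y \<partial>hausdorff_measure CARD('k))"

definition admissible :: "('k::finite, 'n::finite) surface set \<Rightarrow> (real^'n \<Rightarrow> ennreal) set" where
  "admissible \<Gamma> = {\<rho> \<in> borel_measurable borel. \<forall>S\<in>\<Gamma>. surface_integral S (\<lambda>y. \<rho> y ^ CARD('k)) \<ge> 1}"

text \<open>Powers of extended nonnegative numbers for positive real exponents.\<close>

definition ennreal_powr :: "ennreal \<Rightarrow> real \<Rightarrow> ennreal" where
  "ennreal_powr x p = (if x = \<infinity> then \<infinity> else ennreal (enn2real x powr p))"

definition modulus :: "real \<Rightarrow> ('k::finite, 'n::finite) surface set \<Rightarrow> ennreal" where
  "modulus p \<Gamma> = (INF \<rho> \<in> admissible \<Gamma>. \<integral>\<^sup>+ x. ennreal_powr (\<rho> x) p \<partial>lebesgue)"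

definition almost_every_surface ::
    "real \<Rightarrow> (real^'n) set \<Rightarrow> (('k::finite, 'n::finite) surface \<Rightarrow> bool) \<Rightarrow> bool" where
  "almost_every_surface p D P \<longleftrightarrow> modulus p {S \<in> surfaces_in D. \<not> P S} = 0"

text \<open>
  The \<open>A^(1,p)_k\<close> property. Area is defined for \<open>H^k\<close>-measurable sets only, so that a
  vanishing area includes measurability of the set; without it the integral defining
  \<^const>\<open>surface_area\<close> would be a mere lower integral.
\<close>

definition A_property :: "'k::finite itself \<Rightarrow> real \<Rightarrow> (real^'n::finite) set \<Rightarrow> (real^'n \<Rightarrow> real^'n) \<Rightarrow> bool" where
  "A_property (_ :: 'k itself) p D f \<longleftrightarrow>
     almost_every_surface p D (\<lambda>S :: ('k, 'n) surface.
       \<forall>B \<subseteq> surface_image S.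
         B \<in> sets (hausdorff_measure CARD('k)) \<and> surface_area S B = 0 \<longrightarrow>
         f ` B \<in> sets (hausdorff_measure CARD('k)) \<and> surface_area (surface_comp f S) (f ` B) = 0)"

subsection \<open>Finite metric distortion\<close>

definition upper_distortion :: "(real^'n) set \<Rightarrow> (real^'n \<Rightarrow> real^'n::finite) \<Rightarrow> real^'n \<Rightarrow> ereal" where
  "upper_distortion D f x = Limsup (at x within D) (\<lambda>y. ereal (norm (f x - f y) / norm (x - y)))"

definition lower_distortion :: "(real^'n) set \<Rightarrow> (real^'n \<Rightarrow> real^'n::finite) \<Rightarrow> real^'n \<Rightarrow> ereal" where
  "lower_distortion D f x = Liminf (at x within D) (\<lambda>y. ereal (norm (f x - f y) / norm (x - y)))"

definition finite_metric_distortion :: "(real^'n) set \<Rightarrow> (real^'n \<Rightarrow> real^'n::finite) \<Rightarrow> bool" where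
  "finite_metric_distortion D f \<longleftrightarrow>
     (\<forall>A\<subseteq>D. A \<in> null_sets lebesgue \<longrightarrow> f ` A \<in> null_sets lebesgue) \<and>
     (AE x in lebesgue. x \<in> D \<longrightarrow>
        0 < lower_distortion D f x \<and> lower_distortion D f x \<le> upper_distortion D f x \<and>
        upper_distortion D f x < \<infinity>)"

subsection \<open>Topological degree and orientation\<close>

text \<open>
  The Brouwer degree in its analytic form: for bounded open \<open>G\<close>, \<open>f\<close> continuous on the closure
  of \<open>G\<close> and \<open>y\<close> outside the image of the boundary, take any \<open>g\<close> that is continuous on the
  closure, \<open>C\<^sup>1\<close> in \<open>G\<close> with derivative matrix \<open>g'\<close>, uniformly closer to \<open>f\<close> than \<open>y\<close> is to
  the image of the boundary, and has \<open>y\<close> as a regular value. Then \<open>g\<close> attains \<open>y\<close> at finitely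
  many points, and the sum of the signs of the Jacobian there does not depend on \<open>g\<close>.
\<close>

definition regular_approximation ::
    "(real^'n) set \<Rightarrow> (real^'n \<Rightarrow> real^'n) \<Rightarrow> real^'n
      \<Rightarrow> (real^'n \<Rightarrow> real^'n) \<Rightarrow> (real^'n \<Rightarrow> real^'n^'n::finite) \<Rightarrow> bool" where
  "regular_approximation G f y g g' \<longleftrightarrow>
     continuous_on (closure G) g \<and>
     (\<forall>x\<in>G. (g has_derivative (\<lambda>h. g' x *v h)) (at x)) \<and> continuous_on G g' \<and>
     (\<forall>x\<in>closure G. dist (g x) (f x) < infdist y (f ` frontier G)) \<and>
     (\<forall>x\<in>G. g x = y \<longrightarrow> det (g' x) \<noteq> 0)"

definition topological_degree :: "real^'n \<Rightarrow> (real^'n \<Rightarrow> real^'n::finite) \<Rightarrow> (real^'n) set \<Rightarrow> int" where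
  "topological_degree y f G =
     (THE d. \<exists>g g'. regular_approximation G f y g g' \<and>
        of_int d = (\<Sum>x\<in>{x \<in> G. g x = y}. sgn (det (g' x))))"

definition orientation_preserving :: "(real^'n) set \<Rightarrow> (real^'n \<Rightarrow> real^'n::finite) \<Rightarrow> bool" where
  "orientation_preserving D f \<longleftrightarrow>
     (\<forall>G. open G \<and> connected G \<and> G \<noteq> {} \<and> compact (closure G) \<and> closure G \<subseteq> D \<longrightarrow>
        (\<forall>y \<in> f ` G - f ` frontier G. topological_degree y f G > 0))"

subsection \<open>Dilatations\<close>

text \<open>
  The value \<open>\<infinity>\<close> is also given at points where \<open>f\<close> is not differentiable.
\<close>

definition outer_dilatation :: "real \<Rightarrow> (real^'n \<Rightarrow> real^'n::finite) \<Rightarrow> real^'n \<Rightarrow> ennreal" where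
  "outer_dilatation p f x =
     (let f' = frechet_derivative f (at x); J = det (matrix f') in
      if \<not> f differentiable (at x) then \<infinity>
      else if J \<noteq> 0 then ennreal (onorm f' powr p / \<bar>J\<bar>)
      else if f' = (\<lambda>h. 0) then 1
      else \<infinity>)"

definition inner_dilatation_inverse ::
    "real \<Rightarrow> (real^'n \<Rightarrow> real^'n::finite) \<Rightarrow> (real^'n) set \<Rightarrow> real^'n \<Rightarrow> ennreal" where
  "inner_dilatation_inverse p f E y = (\<Sum>\<^sub>\<infinity>x\<in>{x \<in> E. f x = y}. outer_dilatation p f x)"

end

theory Submission
  imports Defs
begin

text \<open>
  The test function is \<open>\<rho>(x) = \<rho>\<^sub>*(f(x)) \<parallel>f'(x)\<parallel>\<close>, up to a factor close to 1. If the right-hand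
  side is finite, then points where \<open>f\<close> is not differentiable and \<open>\<rho>\<^sub>* \<circ> f\<close> does not vanish carry
  \<open>K\<^sub>O = \<infinity>\<close>, so their image is a null set; as \<open>l(x,f) > 0\<close> almost everywhere, \<open>f\<close> has a local Lipschitz
  inverse and the points themselves form a null set. Hence no theorem of Rademacher-Stepanov type is
  needed. The rest of the set is cut into countably many Borel pieces on which \<open>f\<close> is injective and
  nearly linear, and \<open>\<parallel>f'\<parallel>\<close> may be replaced by a Lipschitz constant on each piece. Then
  admissibility follows from the behaviour of Hausdorff measure under Lipschitz maps, and the volume
  bound from the change of variables formula. Surfaces with positive area in the exceptional
  null set are taken care of by the value \<open>\<rho> = \<infinity>\<close> there, and on all others, except for a family of
  zero modulus, the \<open>A\<close>-property makes the image of that null set negligible.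
\<close>

text \<open>Measurability shapes the estimates. The measurability in \<open>x\<close> of the norm of
  the derivative and that in \<open>y\<close> of the dilatation sum are bypassed: on each piece
  constants replace them, a Lipschitz constant \<open>c\<close> in the test function and a lower
  bound \<open>\<kappa>\<close> of the outer dilatation in the volume estimate. The right-hand side
  is used only as an upper bound by monotonicity of \<open>nn_integral\<close>, which is a lower
  integral for an arbitrary integrand. Positive lower distortion makes a derivative injective, so
  almost everywhere on the set of differentiability the Jacobian is nonzero and the first branch of
  the outer dilatation applies. The constants cost the factor \<open>(1 + s) powr (p + 2)\<close>:
  the exponent \<open>p\<close> comes from comparing \<open>c\<close> with the norm, the remaining 2
  from comparing Jacobians once in the dilatation and once in the volume. The same \<open>s\<close>
  bounds the integral of a density for the exceptional family of the A-property, so all errors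
  disappear together as \<open>s\<close> tends to 0.\<close>

lemma nn_integral_le_of_emeasure_le:
  fixes h :: "'a \<Rightarrow> 'c::topological_space" and h' :: "'b \<Rightarrow> 'c"
  assumes P: "P \<inter> space M \<in> sets M" and h: "h \<in> measurable (restrict_space M P) borel"
    and P': "P' \<inter> space N \<in> sets N" and h': "h' \<in> measurable (restrict_space N P') borel"
    and le: "\<And>A. A \<in> sets borel \<Longrightarrow>
      emeasure M (h -` A \<inter> (P \<inter> space M)) \<le> K * emeasure N (h' -` A \<inter> (P' \<inter> space N))"
    and \<psi>: "\<psi> \<in> borel_measurable borel"
  shows "(\<integral>\<^sup>+x\<in>P. \<psi> (h x) \<partial>M) \<le> K * (\<integral>\<^sup>+y\<in>P'. \<psi> (h' y) \<partial>N)"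
proof -
  let ?M = "distr (restrict_space M P) borel h"
  let ?N = "distr (restrict_space N P') borel h'"
  \<comment> \<open>Comparing push-forwards as Borel measures reduces the inequality to Borel sets.
    It is used once for the mapping with Lebesgue measure and once for its inverse with Hausdorff
    measure.\<close>
  have "?M \<le> scale_measure K ?N"
  proof (subst le_measure)
    show "sets ?M = sets (scale_measure K ?N)" by simp
    have "emeasure ?M A \<le> emeasure (scale_measure K ?N) A" if A: "A \<in> sets borel" for A
      using le[OF A] A h h' P P'
      by (simp add: emeasure_distr emeasure_restrict_space space_restrict_space Int_ac)
    then show "\<forall>A\<in>sets ?M. emeasure ?M A \<le> emeasure (scale_measure K ?N) A" by simp
  qed
  then have "nn_integral ?M \<psi> \<le> nn_integral (scale_measure K ?N) \<psi>"
    by (intro nn_integral_mono_measure) simp_all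
  also have "\<dots> = K * nn_integral ?N \<psi>" using \<psi> by (simp add: nn_integral_scale_measure)
  finally show ?thesis
    using \<psi> h h' P P' by (simp add: nn_integral_distr nn_integral_restrict_space)
qed

subsection \<open>Hausdorff measure\<close>

lemma hausdorff_content_antimono:
  assumes "\<delta> \<le> \<delta>'"
  shows "hausdorff_content k \<delta>' A \<le> hausdorff_content k \<delta> A"
  unfolding hausdorff_content_def using assms
  by (intro INF_superset_mono) (auto intro: less_le_trans)

lemma hausdorff_outer_empty:
  assumes "k \<ge> 1" shows "hausdorff_outer k ({}::'a::metric_space set) = 0"
  using outer_measure_space_hausdorff[OF assms, where 'a='a]
  by (auto simp: outer_measure_space_def positive_def)

lemma hausdorff_outer_mono:
  assumes "A \<subseteq> B" shows "hausdorff_outer k A \<le> hausdorff_outer k B"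
  unfolding hausdorff_outer_def using assms by (intro SUP_mono) (auto intro: hausdorff_content_mono)

lemma hausdorff_outer_UN_le:
  fixes A :: "nat \<Rightarrow> 'a::metric_space set"
  shows "hausdorff_outer k (\<Union>i. A i) \<le> (\<Sum>i. hausdorff_outer k (A i))"
  unfolding hausdorff_outer_def[of k "\<Union>i. A i"]
proof (rule SUP_least)
  fix \<delta> :: real assume "\<delta> \<in> {0<..}"
  then have "(\<Sum>i. hausdorff_content k \<delta> (A i)) \<le> (\<Sum>i. hausdorff_outer k (A i))"
    unfolding hausdorff_outer_def by (intro suminf_le SUP_upper) auto
  then show "hausdorff_content k \<delta> (\<Union>i. A i) \<le> (\<Sum>i. hausdorff_outer k (A i))"
    using hausdorff_content_UN_le order_trans by blast
qed

lemma hausdorff_outer_Un_le: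
  fixes A B :: "'a::metric_space set"
  assumes "k \<ge> 1" shows "hausdorff_outer k (A \<union> B) \<le> hausdorff_outer k A + hausdorff_outer k B"
proof -
  have "(\<Sum>i. hausdorff_outer k (binaryset A B i)) = hausdorff_outer k A + hausdorff_outer k B"
    by (rule suminf_binaryset_eq) (use hausdorff_outer_empty[OF assms] in auto)
  then show ?thesis using hausdorff_outer_UN_le[of k "binaryset A B"]
    by (simp add: UN_binaryset_eq)
qed

text \<open>A set of diameter less than \<delta> cannot meet both \<open>A\<close> and
  \<open>B\<close>, so every cover splits into a cover of \<open>A\<close> and one of
  \<open>B\<close>. Discarded members become the empty set, whose weight is 0 because
  \<open>k\<close> is positive.\<close>

lemma hausdorff_content_separated:
  assumes k: "k \<ge> 1" and sep: "\<And>x y. x \<in> A \<Longrightarrow> y \<in> B \<Longrightarrow> \<delta> \<le> dist x y" and \<delta>: "\<delta> > 0"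
  shows "hausdorff_content k \<delta> A + hausdorff_content k \<delta> B \<le> hausdorff_content k \<delta> (A \<union> B)"
  unfolding hausdorff_content_def[of k \<delta> "A \<union> B"]
proof (rule INF_greatest)
  fix C :: "nat \<Rightarrow> 'a set"
  assume "C \<in> {C. A \<union> B \<subseteq> (\<Union>i. C i) \<and> (\<forall>i. bounded (C i) \<and> diameter (C i) < \<delta>)}"
  then have C: "A \<union> B \<subseteq> (\<Union>i. C i)" "\<And>i. bounded (C i)" "\<And>i. diameter (C i) < \<delta>" by auto
  let ?w = "\<lambda>C. ennreal (unit_ball_vol (real k) * (diameter (C::'a set) / 2) ^ k)"
  define CA where "CA i = (if C i \<inter> A = {} then {} else C i)" for i
  define CB where "CB i = (if C i \<inter> B = {} then {} else C i)" for i
  have w0: "?w {} = 0" using k by (simp add: power_0_left)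
  have "hausdorff_content k \<delta> A + hausdorff_content k \<delta> B \<le> (\<Sum>i. ?w (CA i)) + (\<Sum>i. ?w (CB i))"
  proof (intro add_mono hausdorff_content_le)
    show "A \<subseteq> (\<Union>i. CA i)" "B \<subseteq> (\<Union>i. CB i)" using C(1) by (fastforce simp: CA_def CB_def)+
  qed (use C \<delta> in \<open>auto simp: CA_def CB_def\<close>)
  also have "\<dots> = (\<Sum>i. ?w (CA i) + ?w (CB i))" by (intro suminf_add) auto
  also have "\<dots> \<le> (\<Sum>i. ?w (C i))"
  proof (intro suminf_le)
    fix i
    have "C i \<inter> A = {} \<or> C i \<inter> B = {}"
    proof (rule ccontr)
      assume "\<not> ?thesis"
      then obtain x y where "x \<in> C i" "x \<in> A" "y \<in> C i" "y \<in> B" by blast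
      then have "\<delta> \<le> diameter (C i)"
        using sep diameter_bounded_bound[OF C(2)] by (meson order_trans)
      with C(3)[of i] show False by simp
    qed
    then show "?w (CA i) + ?w (CB i) \<le> ?w (C i)" using w0 k by (auto simp: CA_def CB_def power_0_left)
  qed auto
  finally show "hausdorff_content k \<delta> A + hausdorff_content k \<delta> B \<le> (\<Sum>i. ?w (C i))" .
qed

text \<open>Additivity on sets at positive distance is the metric property from which Caratheodory's
  criterion derives the measurability of closed sets.\<close>

lemma hausdorff_outer_separated:
  assumes k: "k \<ge> 1" and sep: "\<And>x y. x \<in> A \<Longrightarrow> y \<in> B \<Longrightarrow> d \<le> dist x y" and d: "d > 0"
  shows "hausdorff_outer k A + hausdorff_outer k B \<le> hausdorff_outer k (A \<union> B)"
proof -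
  have *: "hausdorff_content k a A + hausdorff_content k b B \<le> hausdorff_outer k (A \<union> B)"
    if "a > 0" "b > 0" for a b
  proof -
    \<comment> \<open>Contents grow as the scale shrinks, so the independent scales \<open>a\<close>
      and \<open>b\<close> may be replaced by a common one below \<open>d\<close>. The suprema over
      \<open>a\<close> and \<open>b\<close> can then be taken one after the other.\<close>
    define \<delta> where "\<delta> = min d (min a b)"
    have \<delta>: "\<delta> > 0" "\<delta> \<le> d" "\<delta> \<le> a" "\<delta> \<le> b" using that d by (auto simp: \<delta>_def)
    have "hausdorff_content k a A + hausdorff_content k b B
        \<le> hausdorff_content k \<delta> A + hausdorff_content k \<delta> B"
      using \<delta> by (intro add_mono hausdorff_content_antimono)
    also have "\<dots> \<le> hausdorff_content k \<delta> (A \<union> B)"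
      using \<delta> sep by (intro hausdorff_content_separated k) (auto intro: order_trans)
    also have "\<dots> \<le> hausdorff_outer k (A \<union> B)"
      unfolding hausdorff_outer_def using \<delta> by (intro SUP_upper) auto
    finally show ?thesis .
  qed
  have ne: "{0::real<..} \<noteq> {}" by auto
  have "hausdorff_outer k A + hausdorff_content k b B \<le> hausdorff_outer k (A \<union> B)" if "b > 0" for b
  proof -
    have "hausdorff_outer k A + hausdorff_content k b B
        = (SUP a\<in>{0<..}. hausdorff_content k a A + hausdorff_content k b B)"
      unfolding hausdorff_outer_def by (simp add: ennreal_SUP_add_left[OF ne])
    also have "\<dots> \<le> hausdorff_outer k (A \<union> B)" using that * by (auto intro!: SUP_least)
    finally show ?thesis .
  qed
  then have "(SUP b\<in>{0<..}. hausdorff_outer k A + hausdorff_content k b B) \<le> hausdorff_outer k (A \<union> B)"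
    by (auto intro!: SUP_least)
  also have "(SUP b\<in>{0<..}. hausdorff_outer k A + hausdorff_content k b B) = hausdorff_outer k A + hausdorff_outer k B"
    unfolding hausdorff_outer_def[of k B] by (rule ennreal_SUP_add_right[OF ne, symmetric])
  finally show ?thesis .
qed

text \<open>Caratheodory's criterion. \<open>F n\<close> is separated from
  \<open>A \<inter> C\<close>, and what is left of \<open>A - C\<close> lies in the shells
  \<open>R m\<close> with \<open>m \<ge> n\<close>. Shells of equal parity are separated from each
  other, so their measures have a finite sum and the tails tend to 0.\<close>

lemma closed_in_hausdorff_lambda_system:
  fixes C :: "'a::metric_space set"
  assumes k: "k \<ge> 1" and C: "closed C"
  shows "C \<in> lambda_system UNIV (Pow UNIV) (hausdorff_outer k)"
proof -
  let ?H = "hausdorff_outer k :: 'a set \<Rightarrow> ennreal"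
  have ge: "?H (A \<inter> C) + ?H (A - C) \<le> ?H A" for A
  \<comment> \<open>The empty set is split off because \<open>infdist\<close> to it is 0 by
    convention, so that points outside it would not have positive distance.\<close>
  proof (cases "C = {} \<or> ?H A = \<infinity>")
    case True
    then show ?thesis using hausdorff_outer_empty[OF k, where 'a='a] by auto
  next
    case False
    then have Cne: "C \<noteq> {}" and fin: "?H A < \<infinity>" by (auto simp: less_top)
    define F where "F n = {x \<in> A. 1 / (real n + 1) \<le> infdist x C}" for n :: nat
    define R where "R n = {x \<in> A. 1 / (real n + 2) \<le> infdist x C \<and> infdist x C < 1 / (real n + 1)}" for n :: nat
    have lip: "infdist x C - infdist y C \<le> dist x y" for x y
      using infdist_triangle[of x C y] by (simp add: dist_commute algebra_simps)
    \<comment> \<open>\<open>j\<close> selects the parity. In the induction step the earlier shells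
      keep distance at least \<open>1 / (2N + j)\<close> from \<open>C\<close>, while the new one
      stays below \<open>1 / (2N + j + 1)\<close>. For \<open>N = 0\<close> there is no earlier
      shell and the first quotient may be \<open>1 / 0\<close>, hence the case distinction.\<close>
    have evens: "(\<Sum>m<N. ?H (R (2 * m + j))) \<le> ?H (\<Union>m<N. R (2 * m + j))" for N j
    proof (induction N)
      case (Suc N)
      have sep: "1 / (real (2 * N + j)) - 1 / (real (2 * N + j) + 1) \<le> dist x y"
        if "x \<in> (\<Union>m<N. R (2 * m + j))" "y \<in> R (2 * N + j)" for x y
      proof -
        from that obtain m where m: "m < N" "x \<in> R (2 * m + j)" by auto
        have "1 / (real (2 * N + j)) \<le> 1 / (real (2 * m + j) + 2)"
          using m by (intro divide_left_mono) auto
        also have "\<dots> \<le> infdist x C" using m by (simp add: R_def)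
        finally have "1 / (real (2 * N + j)) \<le> infdist x C" .
        moreover have "infdist y C < 1 / (real (2 * N + j) + 1)" using that by (simp add: R_def)
        ultimately show ?thesis using lip[of x y] by linarith
      qed
      show ?case
      proof (cases "N = 0")
        case False
        then have "1 / (real (2 * N + j)) - 1 / (real (2 * N + j) + 1) > 0"
          by (simp add: divide_simps)
        then have "?H (\<Union>m<N. R (2 * m + j)) + ?H (R (2 * N + j)) \<le> ?H ((\<Union>m<N. R (2 * m + j)) \<union> R (2 * N + j))"
          using sep by (intro hausdorff_outer_separated[OF k])
        moreover have "(\<Union>m<Suc N. R (2 * m + j)) = (\<Union>m<N. R (2 * m + j)) \<union> R (2 * N + j)"
          by (auto simp: less_Suc_eq)
        ultimately show ?thesis using Suc by (auto intro: order_trans add_right_mono)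
      qed (simp add: lessThan_Suc)
    qed (use hausdorff_outer_empty[OF k, where 'a='a] in simp)
    have RA: "?H (\<Union>m<N. R (2 * m + j)) \<le> ?H A" for N j
      by (rule hausdorff_outer_mono) (auto simp: R_def)
    have split: "(\<Sum>m<2*N. ?H (R m)) = (\<Sum>m<N. ?H (R (2*m+0))) + (\<Sum>m<N. ?H (R (2*m+1)))" for N
      by (induction N) (simp_all add: algebra_simps)
    have bd: "(\<Sum>m<N. ?H (R m)) \<le> 2 * ?H A" for N
    proof -
      have "(\<Sum>m<N. ?H (R m)) \<le> (\<Sum>m<2*N. ?H (R m))" by (intro sum_mono2) auto
      also have "\<dots> \<le> ?H A + ?H A" unfolding split
        by (intro add_mono order_trans[OF evens RA])
      finally show ?thesis by (simp add: mult_2)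
    qed
    have S_fin: "(\<Sum>m. ?H (R m)) < \<infinity>"
    proof -
      have "(\<Sum>m. ?H (R m)) \<le> 2 * ?H A" by (intro suminf_le_const bd) simp
      also have "\<dots> < \<infinity>" using fin by (simp add: ennreal_mult_less_top)
      finally show ?thesis .
    qed
    have main: "?H (A \<inter> C) + ?H (A - C) \<le> ?H A + (\<Sum>m. ?H (R (m + n)))" for n
    proof -
      have "A - C \<subseteq> F n \<union> (\<Union>m. R (m + n))"
      proof
        fix x assume x: "x \<in> A - C"
        then have pos: "infdist x C > 0"
          using C Cne infdist_pos_not_in_closed by blast
        show "x \<in> F n \<union> (\<Union>m. R (m + n))"
        proof (cases "x \<in> F n")
          case False
          obtain N where N: "inverse (real (Suc N)) < infdist x C" using reals_Archimedean[OF pos] by auto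
          define P where "P l \<longleftrightarrow> 1 / (real l + 1) \<le> infdist x C" for l
          have PN: "P N" using N by (simp add: P_def inverse_eq_divide add_ac)
          define l where "l = (LEAST l. P l)"
          have "P l" unfolding l_def using PN by (rule LeastI)
          have nP: "\<not> P n" using False x by (simp add: F_def P_def)
          have "l > n"
          proof (rule ccontr)
            assume "\<not> l > n"
            then have "1 / (real n + 1) \<le> 1 / (real l + 1)" by (intro divide_left_mono) auto
            then show False using \<open>P l\<close> nP unfolding P_def by linarith
          qed
          then obtain m where m: "l = Suc (m + n)" using less_imp_Suc_add by (metis add.commute)
          have "\<not> P (m + n)" using not_less_Least[of "m + n" P] m unfolding l_def by simp
          then have "x \<in> R (m + n)" using \<open>P l\<close> x unfolding m P_def R_def by (auto simp: algebra_simps)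
          then show ?thesis by blast
        qed blast
      qed
      then have "?H (A - C) \<le> ?H (F n \<union> (\<Union>m. R (m + n)))" by (rule hausdorff_outer_mono)
      also have "\<dots> \<le> ?H (F n) + ?H (\<Union>m. R (m + n))" by (rule hausdorff_outer_Un_le[OF k])
      also have "\<dots> \<le> ?H (F n) + (\<Sum>m. ?H (R (m + n)))"
        by (intro add_left_mono hausdorff_outer_UN_le)
      finally have "?H (A - C) \<le> ?H (F n) + (\<Sum>m. ?H (R (m + n)))" .
      then have "?H (A \<inter> C) + ?H (A - C) \<le> (?H (A \<inter> C) + ?H (F n)) + (\<Sum>m. ?H (R (m + n)))"
        by (simp add: add.assoc add_left_mono)
      also have "?H (A \<inter> C) + ?H (F n) \<le> ?H ((A \<inter> C) \<union> F n)"
      proof (rule hausdorff_outer_separated[OF k])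
        fix x y assume "x \<in> A \<inter> C" "y \<in> F n"
        then show "1 / (real n + 1) \<le> dist x y" using infdist_le[of x C y]
          by (auto simp: F_def dist_commute)
      qed simp
      also have "\<dots> \<le> ?H A" by (rule hausdorff_outer_mono) (auto simp: F_def)
      finally show ?thesis by (simp add: add_right_mono)
    qed
    show ?thesis
    proof (rule ennreal_le_epsilon)
      fix e :: real assume e: "e > 0"
      let ?S = "\<Sum>m. ?H (R m)"
      \<comment> \<open>The total sum is finite, so some tail, which is the error term in
        \<open>main\<close>, drops below \<open>e\<close>.\<close>
      have "(\<lambda>n. (\<Sum>m<n. ?H (R m)) + ennreal e) \<longlonglongrightarrow> ?S + ennreal e"
        by (intro tendsto_add summable_LIMSEQ tendsto_const) simp
      moreover have "?S < ?S + ennreal e"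
        using S_fin e by (cases ?S) (auto simp: ennreal_plus[symmetric] ennreal_less_iff simp del: ennreal_plus)
      ultimately have "eventually (\<lambda>n. ?S < (\<Sum>m<n. ?H (R m)) + ennreal e) sequentially"
        by (rule order_tendstoD)
      then obtain n where n: "?S < (\<Sum>m<n. ?H (R m)) + ennreal e" by (auto simp: eventually_sequentially)
      have "?S = (\<Sum>m. ?H (R (m + n))) + (\<Sum>m<n. ?H (R m))" by (rule suminf_offset) simp
      then have "(\<Sum>m<n. ?H (R m)) + (\<Sum>m. ?H (R (m + n))) < (\<Sum>m<n. ?H (R m)) + ennreal e"
        using n by (simp add: add.commute)
      then have "(\<Sum>m. ?H (R (m + n))) < ennreal e" by (simp add: ennreal_add_left_cancel_less)
      then show "?H (A \<inter> C) + ?H (A - C) \<le> ?H A + ennreal e"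
        using main[of n] by (meson add_left_mono less_imp_le order_trans)
    qed
  qed
  have "?H (A \<inter> C) + ?H (A - C) = ?H A" for A
  proof (rule antisym[OF ge])
    have "A = (A \<inter> C) \<union> (A - C)" by auto
    then show "?H A \<le> ?H (A \<inter> C) + ?H (A - C)"
      using hausdorff_outer_Un_le[OF k, of "A \<inter> C" "A - C"] by simp
  qed
  then show ?thesis
    by (subst algebra.lambda_system_eq[OF algebra_Pow]) auto
qed

section \<open>Borel sets and functions, and Lipschitz images, under Hausdorff measure\<close>

lemma borel_subset_sets_hausdorff_measure:
  assumes k: "k \<ge> 1"
  shows "sets (borel :: 'a::metric_space measure) \<subseteq> sets (hausdorff_measure k)"
proof -
  have "sigma_sets UNIV (Collect closed) \<subseteq> sets (hausdorff_measure k :: 'a measure)"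
    using closed_in_hausdorff_lambda_system[OF k]
      sets.sigma_sets_subset[of "Collect closed" "hausdorff_measure k :: 'a measure"]
    by (auto simp: sets_hausdorff_measure[OF k] space_hausdorff_measure[OF k])
  then show ?thesis by (simp add: borel_eq_closed)
qed

lemma borel_measurable_hausdorff_measure:
  assumes "k \<ge> 1" "g \<in> measurable borel M"
  shows "g \<in> measurable (hausdorff_measure k :: 'a::metric_space measure) M"
  using assms borel_subset_sets_hausdorff_measure[OF assms(1), where 'a='a]
  by (auto simp: measurable_def space_hausdorff_measure)

lemma hausdorff_content_lipschitz_image:
  fixes f :: "'a::metric_space \<Rightarrow> 'b::metric_space"
  assumes lip: "\<And>x y. x \<in> A \<Longrightarrow> y \<in> A \<Longrightarrow> dist (f x) (f y) \<le> c * dist x y" and c: "c > 0"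
  shows "hausdorff_content k (c * \<delta>) (f ` A) \<le> ennreal (c ^ k) * hausdorff_content k \<delta> A"
proof -
  \<comment> \<open>Dividing by \<open>c ^ k\<close> first leaves the infimum alone on the right, so
    that the claim can be proved cover by cover.\<close>
  have "ennreal (1 / c ^ k) * hausdorff_content k (c * \<delta>) (f ` A) \<le> hausdorff_content k \<delta> A"
    unfolding hausdorff_content_def[of k \<delta> A]
  proof (rule INF_greatest)
    fix C :: "nat \<Rightarrow> 'a set"
    assume "C \<in> {C. A \<subseteq> (\<Union>i. C i) \<and> (\<forall>i. bounded (C i) \<and> diameter (C i) < \<delta>)}"
    then have C: "A \<subseteq> (\<Union>i. C i)" "\<And>i. bounded (C i)" "\<And>i. diameter (C i) < \<delta>" by auto
    let ?B = "\<lambda>i. f ` (C i \<inter> A)"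
    have d: "dist u v \<le> c * diameter (C i)" if "u \<in> ?B i" "v \<in> ?B i" for u v i
    proof -
      from that obtain x y where xy: "x \<in> C i" "x \<in> A" "y \<in> C i" "y \<in> A" and uv: "u = f x" "v = f y"
        by blast
      have "dist (f x) (f y) \<le> c * dist x y" using lip xy by simp
      also have "\<dots> \<le> c * diameter (C i)"
        using c diameter_bounded_bound[OF C(2)] xy by (intro mult_left_mono) auto
      finally show ?thesis using uv by simp
    qed
    have bd: "bounded (?B i)" for i unfolding bounded_two_points using d by blast
    have dia: "diameter (?B i) \<le> c * diameter (C i)" for i
    proof (cases "?B i = {}")
      case False
      then have "(SUP (u, v)\<in>?B i \<times> ?B i. dist u v) \<le> c * diameter (C i)"
        by (intro cSUP_least) (use d in \<open>auto simp del: image_Int\<close>)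
      then show ?thesis using False by (simp add: diameter_def[of "?B i"])
    qed (use c diameter_ge_0[OF C(2)] in simp)
    have "hausdorff_content k (c * \<delta>) (f ` A)
        \<le> (\<Sum>i. ennreal (unit_ball_vol (real k) * (diameter (?B i) / 2) ^ k))"
    proof (rule hausdorff_content_le[OF _ bd])
      show "f ` A \<subseteq> (\<Union>i. ?B i)" using C(1) by blast
      show "diameter (?B i) < c * \<delta>" for i
        using dia[of i] C(3)[of i] c by (meson le_less_trans mult_less_cancel_left_pos)
    qed
    also have "\<dots> \<le> (\<Sum>i. ennreal (c ^ k) * ennreal (unit_ball_vol (real k) * (diameter (C i) / 2) ^ k))"
    proof (intro suminf_le)
      fix i
      have "(diameter (?B i) / 2) ^ k \<le> (c * diameter (C i) / 2) ^ k"
        using dia[of i] diameter_ge_0[OF bd] by (intro power_mono) auto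
      then have "unit_ball_vol (real k) * (diameter (?B i) / 2) ^ k
          \<le> unit_ball_vol (real k) * (c * diameter (C i) / 2) ^ k"
        by (intro mult_left_mono) auto
      also have "\<dots> = c ^ k * (unit_ball_vol (real k) * (diameter (C i) / 2) ^ k)"
        by (simp add: power_mult_distrib power_divide)
      finally show "ennreal (unit_ball_vol (real k) * (diameter (?B i) / 2) ^ k)
          \<le> ennreal (c ^ k) * ennreal (unit_ball_vol (real k) * (diameter (C i) / 2) ^ k)"
        using c by (subst ennreal_mult'[symmetric]) (auto intro: ennreal_leI)
    qed auto
    also have "\<dots> = ennreal (c ^ k) * (\<Sum>i. ennreal (unit_ball_vol (real k) * (diameter (C i) / 2) ^ k))"
      by simp
    finally have "ennreal (1 / c ^ k) * hausdorff_content k (c * \<delta>) (f ` A) \<le>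
       ennreal (1 / c ^ k) * (ennreal (c ^ k) * (\<Sum>i. ennreal (unit_ball_vol (real k) * (diameter (C i) / 2) ^ k)))"
      by (rule mult_left_mono) simp
    then show "ennreal (1 / c ^ k) * hausdorff_content k (c * \<delta>) (f ` A) \<le>
        (\<Sum>i. ennreal (unit_ball_vol (real k) * (diameter (C i) / 2) ^ k))"
      using c by (simp add: mult.assoc[symmetric] ennreal_mult'[symmetric] del: ennreal_suminf_cmult)
  qed
  then have "ennreal (c ^ k) * (ennreal (1 / c ^ k) * hausdorff_content k (c * \<delta>) (f ` A))
      \<le> ennreal (c ^ k) * hausdorff_content k \<delta> A"
    by (rule mult_left_mono) simp
  then show ?thesis using c by (simp add: mult.assoc[symmetric] ennreal_mult'[symmetric])
qed

lemma hausdorff_outer_lipschitz_image: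
  fixes f :: "'a::metric_space \<Rightarrow> 'b::metric_space"
  assumes lip: "\<And>x y. x \<in> A \<Longrightarrow> y \<in> A \<Longrightarrow> dist (f x) (f y) \<le> c * dist x y" and c: "c > 0"
  shows "hausdorff_outer k (f ` A) \<le> ennreal (c ^ k) * hausdorff_outer k A"
  unfolding hausdorff_outer_def[of k "f ` A"]
proof (rule SUP_least)
  fix \<delta> :: real assume \<delta>: "\<delta> \<in> {0<..}"
  have "hausdorff_content k \<delta> (f ` A) \<le> ennreal (c ^ k) * hausdorff_content k (\<delta> / c) A"
    using hausdorff_content_lipschitz_image[OF lip c, where \<delta>="\<delta> / c"] c by simp
  also have "\<dots> \<le> ennreal (c ^ k) * hausdorff_outer k A"
    unfolding hausdorff_outer_def using \<delta> c by (intro mult_left_mono SUP_upper) auto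
  finally show "hausdorff_content k \<delta> (f ` A) \<le> ennreal (c ^ k) * hausdorff_outer k A" .
qed

subsection \<open>Volume of differentiable images\<close>

text \<open>
  The change of variables theorem of the library is restricted to \<open>real^'n\<close> with a
  well-ordered index type \<open>'n\<close>. The following copy of a finite type carries an arbitrary
  well-order and serves to remove that restriction.
\<close>

typedef 'n indexcopy = "UNIV :: 'n set" morphisms of_indexcopy to_indexcopy by simp

lemma bij_of_indexcopy: "bij of_indexcopy"
  by (metis bijI' of_indexcopy_inject of_indexcopy_cases UNIV_I)

lemma bij_to_indexcopy: "bij to_indexcopy"
  by (metis bijI' UNIV_I of_indexcopy_inverse to_indexcopy_inject)

instance indexcopy :: (finite) finite
  by standard (use bij_of_indexcopy finite bij_betw_finite in blast)

definition index_rank :: "'n::finite \<Rightarrow> nat" where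
  "index_rank = (SOME g. inj g)"

lemma inj_index_rank: "inj (index_rank :: 'n::finite \<Rightarrow> nat)"
proof -
  have "\<exists>g :: 'n \<Rightarrow> nat. inj g"
    using finite_imp_inj_to_nat_seg[of "UNIV :: 'n set"] by auto
  then show ?thesis unfolding index_rank_def by (rule someI_ex)
qed

instantiation indexcopy :: (finite) wellorder
begin

definition less_eq_indexcopy :: "'a indexcopy \<Rightarrow> 'a indexcopy \<Rightarrow> bool" where
  "less_eq_indexcopy i j \<longleftrightarrow> index_rank (of_indexcopy i) \<le> index_rank (of_indexcopy j)"

definition less_indexcopy :: "'a indexcopy \<Rightarrow> 'a indexcopy \<Rightarrow> bool" where
  "less_indexcopy i j \<longleftrightarrow> index_rank (of_indexcopy i) < index_rank (of_indexcopy j)"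

instance
proof
  fix P :: "'a indexcopy \<Rightarrow> bool" and a
  assume IH: "\<And>x. (\<And>y. y < x \<Longrightarrow> P y) \<Longrightarrow> P x"
  show "P a"
    by (induction a rule: measure_induct_rule[of "\<lambda>i. index_rank (of_indexcopy i)"])
      (rule IH, simp add: less_indexcopy_def)
qed (auto simp: less_eq_indexcopy_def less_indexcopy_def of_indexcopy_inject
        dest: injD[OF inj_index_rank])

end

section \<open>Transport of Lebesgue measure and determinants to the copied index type\<close>

definition vec_copy :: "'a^'n \<Rightarrow> 'a^('n::finite) indexcopy" where
  "vec_copy v = (\<chi> i. v $ of_indexcopy i)"

definition vec_uncopy :: "'a^('n::finite) indexcopy \<Rightarrow> 'a^'n" where
  "vec_uncopy v = (\<chi> i. v $ to_indexcopy i)"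

lemma vec_copy_inverses [simp]: "vec_uncopy (vec_copy v) = v" "vec_copy (vec_uncopy w) = w"
  by (simp_all add: vec_copy_def vec_uncopy_def vec_eq_iff to_indexcopy_inverse of_indexcopy_inverse)

lemma linear_vec_copy: "linear (vec_copy :: real^'n \<Rightarrow> real^('n::finite) indexcopy)"
  by (rule linearI) (auto simp: vec_copy_def vec_eq_iff)

lemma linear_vec_uncopy: "linear (vec_uncopy :: real^('n::finite) indexcopy \<Rightarrow> real^'n)"
  by (rule linearI) (auto simp: vec_uncopy_def vec_eq_iff)

lemma bij_vec_copy: "bij (vec_copy :: 'a^'n \<Rightarrow> 'a^('n::finite) indexcopy)"
  by (rule o_bij[of vec_uncopy]) (auto simp: fun_eq_iff)

lemma vec_copy_axis: "vec_copy (axis (of_indexcopy i) c) = axis i c"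
  by (auto simp: vec_copy_def axis_def vec_eq_iff of_indexcopy_inject)

lemma vec_uncopy_axis: "vec_uncopy (axis i c) = axis (of_indexcopy i) c"
  by (metis vec_copy_axis vec_copy_inverses(1))

lemma prod_Basis_cart: "(\<Prod>b\<in>Basis. (v :: real^'n::finite) \<bullet> b) = (\<Prod>i\<in>UNIV. v $ i)"
proof -
  have "Basis = range (\<lambda>i. axis i (1::real) :: real^'n)" by (auto simp: Basis_vec_def)
  moreover have "inj (\<lambda>i. axis i (1::real) :: real^'n)" by (auto simp: inj_on_def axis_eq_axis)
  ultimately have "(\<Prod>b\<in>Basis. v \<bullet> b) = (\<Prod>i\<in>UNIV. v \<bullet> axis i 1)"
    by (metis prod.reindex_cong)
  then show ?thesis by (simp add: inner_axis)
qed

text \<open>Renaming coordinates turns boxes into boxes with the same side lengths, and the values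
  on boxes determine Lebesgue measure.\<close>

lemma lborel_distr_vec_copy:
  "distr lborel borel (vec_copy :: real^'n \<Rightarrow> real^('n::finite) indexcopy) = lborel"
proof (rule lborel_eqI[symmetric])
  fix l u :: "real^'n indexcopy"
  assume le: "\<And>b. b \<in> Basis \<Longrightarrow> l \<bullet> b \<le> u \<bullet> b"
  have meas: "vec_copy \<in> borel_measurable (borel :: (real^'n) measure)"
    using linear_vec_copy by (intro borel_measurable_continuous_onI linear_continuous_on)
      (simp add: linear_conv_bounded_linear)
  have le': "l $ i \<le> u $ i" for i
    using le[of "axis i 1"] by (simp add: inner_axis axis_in_Basis_iff)
  have "vec_copy -` box l u = box (vec_uncopy l) (vec_uncopy u)"
  proof -
    have "(\<forall>i. P (of_indexcopy i) i) \<longleftrightarrow> (\<forall>j. P j (to_indexcopy j))" for P :: "'n \<Rightarrow> 'n indexcopy \<Rightarrow> bool"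
      by (metis of_indexcopy_inverse to_indexcopy_inverse UNIV_I)
    note * = this[of "\<lambda>j i. l $ i < x $ j \<and> x $ j < u $ i" for x]
    show ?thesis
      by (auto simp: mem_box_cart vec_copy_def vec_uncopy_def *[simplified])
  qed
  then have "emeasure (distr lborel borel vec_copy) (box l u)
      = emeasure lborel (box (vec_uncopy l) (vec_uncopy u))"
    using meas by (subst emeasure_distr) auto
  also have "\<dots> = (\<Prod>b\<in>Basis. (vec_uncopy u - vec_uncopy l) \<bullet> b)"
    using le' by (intro emeasure_lborel_box) (auto simp: Basis_vec_def inner_axis vec_uncopy_def)
  also have "(\<Prod>b\<in>Basis. (vec_uncopy u - vec_uncopy l) \<bullet> b) = (\<Prod>i\<in>UNIV. (vec_uncopy u - vec_uncopy l) $ i)"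
    by (rule prod_Basis_cart)
  also have "\<dots> = (\<Prod>i\<in>UNIV. (u - l) $ i)"
    using prod.reindex_bij_betw[OF bij_to_indexcopy, of "\<lambda>i. (u - l) $ i"] by (simp add: vec_uncopy_def)
  also have "\<dots> = (\<Prod>b\<in>Basis. (u - l) \<bullet> b)"
    by (rule prod_Basis_cart[symmetric])
  finally show "emeasure (distr lborel borel vec_copy) (box l u) = (\<Prod>b\<in>Basis. (u - l) \<bullet> b)" .
qed simp

text \<open>In the Leibniz formula, conjugation with the bijection of indices is a sign-preserving
  bijection of permutations that matches the products.\<close>

lemma det_vec_copy:
  fixes M :: "real^'n^('n::finite)"
  shows "det (\<chi> i j. M $ of_indexcopy i $ of_indexcopy j) = det M"
proof -
  let ?r = "of_indexcopy :: 'n indexcopy \<Rightarrow> 'n" and ?s = "to_indexcopy :: 'n \<Rightarrow> 'n indexcopy"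
  have bij: "bij_betw (\<lambda>p. map_permutation UNIV ?r p) {p. p permutes UNIV} {p. p permutes UNIV}"
  proof (rule bij_betw_byWitness[where f' = "\<lambda>p. map_permutation UNIV ?s p"])
    show "\<forall>p\<in>{p. p permutes UNIV}. map_permutation UNIV ?s (map_permutation UNIV ?r p) = p"
      using bij_of_indexcopy by (auto intro!: map_permutation_compose_inv simp: of_indexcopy_inverse)
    show "\<forall>p\<in>{p. p permutes UNIV}. map_permutation UNIV ?r (map_permutation UNIV ?s p) = p"
      using bij_to_indexcopy by (auto intro!: map_permutation_compose_inv simp: to_indexcopy_inverse)
  qed (auto intro!: map_permutation_permutes simp: bij_of_indexcopy bij_to_indexcopy)
  have "det M = (\<Sum>p | p permutes (UNIV :: 'n indexcopy set).
      of_int (sign (map_permutation UNIV ?r p)) * (\<Prod>j\<in>UNIV. M $ j $ map_permutation UNIV ?r p j))"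
    unfolding det_def by (subst sum.reindex_bij_betw[OF bij, symmetric]) (rule refl)
  also have "\<dots> = (\<Sum>p | p permutes (UNIV :: 'n indexcopy set).
      of_int (sign p) * (\<Prod>i\<in>UNIV. M $ ?r i $ ?r (p i)))"
  proof (rule sum.cong[OF refl])
    fix p :: "'n indexcopy \<Rightarrow> 'n indexcopy" assume p: "p \<in> {p. p permutes UNIV}"
    have inj: "inj ?r" using bij_of_indexcopy by (rule bij_is_inj)
    have "(\<Prod>j\<in>UNIV. M $ j $ map_permutation UNIV ?r p j)
        = (\<Prod>i\<in>UNIV. M $ ?r i $ map_permutation UNIV ?r p (?r i))"
      by (rule prod.reindex_bij_betw[OF bij_of_indexcopy, symmetric])
    then show "of_int (sign (map_permutation UNIV ?r p)) * (\<Prod>j\<in>UNIV. M $ j $ map_permutation UNIV ?r p j)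
        = of_int (sign p) * (\<Prod>i\<in>UNIV. M $ ?r i $ ?r (p i))"
      using p inj by (simp add: sign_map_permutation map_permutation_apply)
  qed
  also have "\<dots> = det (\<chi> i j. M $ ?r i $ ?r j)"
    unfolding det_def by simp
  finally show ?thesis ..
qed

text \<open>If the image has finite measure, that measure is the integral of the absolute Jacobian
  by the change of variables formula; otherwise the bound is trivial.\<close>

lemma emeasure_differentiable_image_ge_wellorder:
  fixes f :: "real^'n::{finite,wellorder} \<Rightarrow> real^'n::_"
  assumes A: "A \<in> lmeasurable" and fA: "f ` A \<in> sets lebesgue" and inj: "inj_on f A"
    and der: "\<And>x. x \<in> A \<Longrightarrow> (f has_derivative f' x) (at x)"
    and d: "\<And>x. x \<in> A \<Longrightarrow> d \<le> \<bar>det (matrix (f' x))\<bar>"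
  shows "ennreal d * emeasure lebesgue A \<le> emeasure lebesgue (f ` A)"
proof (cases "f ` A \<in> lmeasurable")
  case True
  have "((\<lambda>x. \<bar>det (matrix (f' x))\<bar>) has_integral measure lebesgue (f ` A)) A"
    using True A der inj
    by (subst has_measure_differentiable_image[symmetric]) (auto intro: has_derivative_at_withinI)
  note int_det = this
  have int_d: "((\<lambda>x. d) has_integral d * measure lebesgue A) A"
  proof -
    have "((\<lambda>x. 1) has_integral measure lebesgue A) A"
      using A by (simp add: lmeasure_integral integrable_integral flip: lmeasurable_iff_integrable_on)
    from has_integral_mult_right[OF this, of d] show ?thesis by simp
  qed
  have "d * measure lebesgue A \<le> measure lebesgue (f ` A)"
    by (rule has_integral_le[OF int_d int_det d])
  then have "ennreal d * ennreal (measure lebesgue A) \<le> ennreal (measure lebesgue (f ` A))"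
    by (subst ennreal_mult''[symmetric]) (auto intro: ennreal_leI)
  then show ?thesis
    using emeasure_eq_measure2[OF True] emeasure_eq_measure2[OF A] by simp
next
  case False
  then have "emeasure lebesgue (f ` A) = \<infinity>"
    using fA fmeasurableI[of "f ` A" lebesgue] by (metis infinity_ennreal_def top.not_eq_extremum)
  then show ?thesis by simp
qed

text \<open>The map is conjugated with \<open>vec_copy\<close>. The sets are Borel because
  \<open>lborel_distr_vec_copy\<close> compares measures on Borel sets, and boundedness makes
  \<open>A\<close> a set of finite measure.\<close>

lemma emeasure_differentiable_image_ge:
  fixes f :: "real^'n \<Rightarrow> real^'n::finite"
  assumes A: "A \<in> sets borel" "bounded A" and fA: "f ` A \<in> sets borel" and inj: "inj_on f A"
    and der: "\<And>x. x \<in> A \<Longrightarrow> (f has_derivative f' x) (at x)"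
    and d: "\<And>x. x \<in> A \<Longrightarrow> d \<le> \<bar>det (matrix (f' x))\<bar>"
  shows "ennreal d * emeasure lebesgue A \<le> emeasure lebesgue (f ` A)"
proof -
  let ?c = "vec_copy :: real^'n \<Rightarrow> real^'n indexcopy" and ?u = "vec_uncopy :: real^'n indexcopy \<Rightarrow> real^'n"
  have bl: "bounded_linear ?c" "bounded_linear ?u"
    using linear_vec_copy linear_vec_uncopy by (simp_all add: linear_conv_bounded_linear)
  have meas: "?c \<in> borel_measurable borel" "?u \<in> borel_measurable borel"
    using bl by (auto intro!: borel_measurable_continuous_onI linear_continuous_on)
  have im: "?c ` B = ?u -` B" for B
    by (auto simp: image_iff) (metis vec_copy_inverses(2))
  have borel: "?c ` B \<in> sets borel" if "B \<in> sets borel" for B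
    unfolding im using measurable_sets[OF meas(2) that] by simp
  have em: "emeasure lebesgue (?c ` B) = emeasure lebesgue B" if B: "B \<in> sets borel" for B
  proof -
    have "emeasure lborel (?c ` B) = emeasure (distr lborel borel ?c) (?c ` B)"
      by (simp add: lborel_distr_vec_copy)
    also have "\<dots> = emeasure lborel (?c -` (?c ` B))"
      using meas borel[OF B] by (subst emeasure_distr) auto
    also have "?c -` (?c ` B) = B"
      by (rule inj_vimage_image_eq) (rule bij_is_inj[OF bij_vec_copy])
    finally show ?thesis using B borel[OF B] by simp
  qed
  define F where "F = ?c \<circ> f \<circ> ?u"
  define F' where "F' y = ?c \<circ> f' (?u y) \<circ> ?u" for y
  have FA: "F ` (?c ` A) = ?c ` (f ` A)" by (auto simp: F_def image_iff)
  have "ennreal d * emeasure lebesgue (?c ` A) \<le> emeasure lebesgue (F ` (?c ` A))"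
  proof (rule emeasure_differentiable_image_ge_wellorder[where f' = F'])
    show "?c ` A \<in> lmeasurable"
      using A borel bounded_linear_image[OF _ bl(1)] by (intro bounded_set_imp_lmeasurable) auto
    show "F ` (?c ` A) \<in> sets lebesgue" unfolding FA using borel fA by auto
    show "inj_on F (?c ` A)"
      using inj by (auto simp: inj_on_def F_def) (metis vec_copy_inverses(1))
    fix y assume "y \<in> ?c ` A"
    then have u: "?u y \<in> A" by auto
    have "((\<lambda>z. ?c (f (?u z))) has_derivative (\<lambda>z. ?c (f' (?u y) (?u z)))) (at y)"
      by (intro bounded_linear.has_derivative[OF bl(1)] has_derivative_compose[of ?u ?u y UNIV f "f' (?u y)", simplified]
          bounded_linear_imp_has_derivative bl der u)
    then show "(F has_derivative F' y) (at y)"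
      by (simp add: F_def F'_def o_def)
    have "matrix (F' y) = (\<chi> i j. matrix (f' (?u y)) $ of_indexcopy i $ of_indexcopy j)"
      by (auto simp: matrix_def F'_def vec_eq_iff vec_copy_def vec_uncopy_axis)
    then show "d \<le> \<bar>det (matrix (F' y))\<bar>"
      using d[OF u] by (simp add: det_vec_copy)
  qed
  then show ?thesis unfolding FA using em A fA by simp
qed

subsection \<open>Multiplicity\<close>

text \<open>
  A fibre has at least \<open>m\<close> points iff \<open>y\<close> lies in the image of \<open>m\<close> disjoint compact sets
  from a fixed countable family.
\<close>

lemma borel_measurable_card_fibre:
  fixes h :: "'a::euclidean_space \<Rightarrow> 'b::t2_space"
  assumes V: "open V" and h: "continuous_on V h"
  shows "(\<lambda>y. emeasure (count_space UNIV) {v \<in> V. h v = y}) \<in> borel_measurable borel"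
proof -
  obtain B :: "'a set set" where B: "countable B" "topological_basis B"
    using ex_countable_basis by blast
  define \<K> where "\<K> = {K \<in> closure ` B. compact K \<and> K \<subseteq> V}"
  define \<F> where "\<F> = {F. finite F \<and> F \<subseteq> \<K> \<and> disjoint F}"
  have cK: "countable \<K>" unfolding \<K>_def using B(1) by auto
  have "countable \<F>"
    unfolding \<F>_def using countable_Collect_finite_subset[OF cK] by (rule countable_subset[rotated]) auto
  have eq: "emeasure (count_space UNIV) {v \<in> V. h v = y} = (SUP F\<in>\<F>. \<Sum>K\<in>F. indicator (h ` K) y)" for y
  proof (rule antisym)
    let ?X = "{v \<in> V. h v = y}"
    \<comment> \<open>For a finite part \<open>X\<close> of the fibre, one radius \<open>r\<close>
      gives disjoint closed balls inside \<open>V\<close>. Shrinking the balls to closures of basis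
      elements brings them into the countable family.\<close>
    have fin: "of_nat (card X) \<le> (SUP F\<in>\<F>. \<Sum>K\<in>F. indicator (h ` K) y :: ennreal)"
      if X: "finite X" "X \<subseteq> ?X" for X
    proof -
      have "\<forall>x\<in>X. eventually (\<lambda>r. cball x r \<subseteq> V) (at_right 0)"
      proof
        fix x assume "x \<in> X"
        then obtain e where e: "e > 0" "cball x e \<subseteq> V"
          using V X(2) open_contains_cball by blast
        then show "eventually (\<lambda>r. cball x r \<subseteq> V) (at_right 0)"
          by (intro eventually_at_rightI[of 0 e]) auto
      qed
      moreover have "\<forall>x\<in>X. \<forall>x'\<in>X. eventually (\<lambda>r. x \<noteq> x' \<longrightarrow> 2 * r < dist x x') (at_right 0)"
      proof (intro ballI)
        fix x x' assume "x \<in> X" "x' \<in> X"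
        show "eventually (\<lambda>r. x \<noteq> x' \<longrightarrow> 2 * r < dist x x') (at_right 0)"
          by (cases "x = x'") (auto intro!: eventually_at_rightI[of 0 "dist x x' / 2"])
      qed
      ultimately have "eventually (\<lambda>r. r > 0 \<and> (\<forall>x\<in>X. cball x r \<subseteq> V) \<and>
          (\<forall>x\<in>X. \<forall>x'\<in>X. x \<noteq> x' \<longrightarrow> 2 * r < dist x x')) (at_right 0)"
        using X(1) by (intro eventually_conj eventually_ball_finite ballI eventually_at_right_less) blast+
      then have "\<exists>r. r > 0 \<and> (\<forall>x\<in>X. cball x r \<subseteq> V) \<and>
          (\<forall>x\<in>X. \<forall>x'\<in>X. x \<noteq> x' \<longrightarrow> 2 * r < dist x x')"
        by (rule eventually_happens'[rotated]) simp
      then obtain r where r: "r > 0" "\<And>x. x \<in> X \<Longrightarrow> cball x r \<subseteq> V"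
          "\<And>x x'. x \<in> X \<Longrightarrow> x' \<in> X \<Longrightarrow> x \<noteq> x' \<Longrightarrow> 2 * r < dist x x'"
        by auto
      have "\<exists>b. b \<in> B \<and> x \<in> b \<and> b \<subseteq> ball x r" for x
        using topological_basisE[OF B(2) open_ball, of x x r] r(1) by (metis centre_in_ball)
      then obtain b where b: "\<And>x. b x \<in> B" "\<And>x. x \<in> b x" "\<And>x. b x \<subseteq> ball x r" by metis
      define K where "K x = closure (b x)" for x
      have Kr: "K x \<subseteq> cball x r" for x
        unfolding K_def using subset_trans[OF b(3) ball_subset_cball] closed_cball by (rule closure_minimal)
      have xK: "x \<in> K x" for x unfolding K_def using b(2) closure_subset by blast
      have disj: "K x \<inter> K x' = {}" if "x \<in> X" "x' \<in> X" "x \<noteq> x'" for x x'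
      proof (rule ccontr)
        assume "K x \<inter> K x' \<noteq> {}"
        then obtain z where "dist x z \<le> r" "dist x' z \<le> r" using Kr by (auto simp: subset_eq)
        then have "dist x x' \<le> 2 * r" using dist_triangle[of x x' z] by (simp add: dist_commute)
        then show False using r(3)[OF that] by simp
      qed
      have inj: "inj_on K X" using disj xK by (metis Int_iff empty_iff inj_onI)
      have "K x \<in> \<K>" if "x \<in> X" for x
        using b(1) r(2)[OF that] Kr[of x] unfolding \<K>_def K_def
        by (auto intro: bounded_subset[OF bounded_cball] simp: compact_eq_bounded_closed)
      moreover have "disjoint (K ` X)"
        using disj by (auto simp: disjoint_def)
      ultimately have F: "K ` X \<in> \<F>" using X(1) by (auto simp: \<F>_def)
      have "(\<Sum>K\<in>K ` X. indicator (h ` K) y :: ennreal) = (\<Sum>x\<in>X. 1)"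
        unfolding sum.reindex[OF inj] o_def using X(2) xK by (intro sum.cong) (auto simp: indicator_def)
      then have "of_nat (card X) = (\<Sum>K\<in>K ` X. indicator (h ` K) y :: ennreal)" by simp
      also have "\<dots> \<le> (SUP F\<in>\<F>. \<Sum>K\<in>F. indicator (h ` K) y)" using F by (rule SUP_upper)
      finally show ?thesis .
    qed
    show "emeasure (count_space UNIV) ?X \<le> (SUP F\<in>\<F>. \<Sum>K\<in>F. indicator (h ` K) y)"
    proof (cases "finite ?X")
      case True
      then show ?thesis using fin[OF True] by (simp add: emeasure_count_space)
    next
      case False
      have "of_nat n \<le> (SUP F\<in>\<F>. \<Sum>K\<in>F. indicator (h ` K) y :: ennreal)" for n
        using infinite_arbitrarily_large[OF False, of n] fin by blast
      then have "(SUP n. of_nat n) \<le> (SUP F\<in>\<F>. \<Sum>K\<in>F. indicator (h ` K) y :: ennreal)"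
        by (rule SUP_least)
      then have "(SUP F\<in>\<F>. \<Sum>K\<in>F. indicator (h ` K) y :: ennreal) = top"
        by (simp add: ennreal_SUP_of_nat_eq_top top_unique)
      then show ?thesis by (simp only: top_greatest)
    qed
  next
    show "(SUP F\<in>\<F>. \<Sum>K\<in>F. indicator (h ` K) y) \<le> emeasure (count_space UNIV) {v \<in> V. h v = y}"
    proof (rule SUP_least)
      fix F assume F: "F \<in> \<F>"
      let ?F = "{K \<in> F. y \<in> h ` K}"
      have "finite F" using F by (simp add: \<F>_def)
      then have "(\<Sum>K\<in>F. indicator (h ` K) y :: ennreal) = (\<Sum>K\<in>?F. 1)"
        by (intro sum.mono_neutral_cong_right) (auto simp: indicator_def)
      then have s: "(\<Sum>K\<in>F. indicator (h ` K) y :: ennreal) = of_nat (card ?F)" by simp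
      have "\<forall>K\<in>?F. \<exists>v. v \<in> K \<and> h v = y" by auto
      then obtain v where v: "\<And>K. K \<in> ?F \<Longrightarrow> v K \<in> K \<and> h (v K) = y" by metis
      have "inj_on v ?F"
      proof (rule inj_onI)
        fix K K' assume K: "K \<in> ?F" "K' \<in> ?F" "v K = v K'"
        then have "v K \<in> K \<inter> K'" using v by (metis IntI)
        moreover have "disjoint F" using F by (simp add: \<F>_def)
        ultimately show "K = K'" using K(1,2) unfolding disjoint_def by blast
      qed
      moreover have "v ` ?F \<subseteq> {v \<in> V. h v = y}"
        using v F by (fastforce simp: \<F>_def \<K>_def)
      ultimately have "card ?F \<le> card {v \<in> V. h v = y}" if "finite {v \<in> V. h v = y}"
        using that by (rule card_inj_on_le)
      then show "(\<Sum>K\<in>F. indicator (h ` K) y) \<le> emeasure (count_space UNIV) {v \<in> V. h v = y}"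
        unfolding s by (simp add: emeasure_count_space)
    qed
  qed
  \<comment> \<open>Compact images are closed in a Hausdorff space, so every indicator in the
    supremum is a Borel function.\<close>
  have "h ` K \<in> sets borel" if "K \<in> \<K>" for K
    using that h by (auto simp: \<K>_def intro!: borel_closed compact_imp_closed compact_continuous_image
        intro: continuous_on_subset)
  then show ?thesis
    unfolding eq using \<open>countable \<F>\<close>
    by (intro borel_measurable_SUP borel_measurable_sum borel_measurable_indicator) (auto simp: \<F>_def)
qed

text \<open>The finite parameters form an open set in Euclidean space, where
  \<open>borel_measurable_card_fibre\<close> applies. The point at infinity adds one to the count at
  the single value \<open>g None\<close>.\<close>

lemma borel_measurable_multiplicity_fun:
  fixes S :: "('k::finite, 'n::finite) surface"
  assumes "S \<in> surfaces_in A"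
  shows "multiplicity_fun S \<in> borel_measurable borel"
proof -
  obtain \<omega> g where S: "S = (\<omega>, g)" by (cases S)
  let ?X = "Alexandroff_compactification (euclidean :: (real^'k) topology)"
  from assms have \<omega>: "openin ?X \<omega>"
    and g: "continuous_map (subtopology ?X \<omega>) (top_of_set A) g"
    by (auto simp: surfaces_in_def S)
  define V where "V = Some -` \<omega>"
  have V: "open V"
    using openin_continuous_map_preimage[OF continuous_map_Some \<omega>] by (simp add: V_def vimage_def)
  have "continuous_map (top_of_set V) (subtopology ?X \<omega>) Some"
    by (intro continuous_map_into_subtopology continuous_map_from_subtopology continuous_map_Some)
      (auto simp: V_def)
  then have "continuous_map (top_of_set V) (top_of_set A) (g \<circ> Some)"
    using g by (rule continuous_map_compose)
  then have h: "continuous_on V (g \<circ> Some)" by (simp add: continuous_map_in_subtopology)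
  have "multiplicity_fun S y = emeasure (count_space UNIV) {v \<in> V. (g \<circ> Some) v = y}
      + indicator (if None \<in> \<omega> then {g None} else {}) y" for y
  proof -
    have eq: "{u \<in> \<omega>. g u = y} = Some ` {v \<in> V. (g \<circ> Some) v = y} \<union> (if None \<in> \<omega> \<and> g None = y then {None} else {})"
    proof -
      have "u \<in> {u \<in> \<omega>. g u = y} \<longleftrightarrow> u \<in> Some ` {v \<in> V. (g \<circ> Some) v = y} \<union> (if None \<in> \<omega> \<and> g None = y then {None} else {})" for u
        by (cases u) (auto simp: V_def)
      then show ?thesis by blast
    qed
    have "multiplicity_fun S y = emeasure (count_space UNIV) (Some ` {v \<in> V. (g \<circ> Some) v = y})
        + emeasure (count_space UNIV) (if None \<in> \<omega> \<and> g None = y then {None :: (real^'k) option} else {})"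
      unfolding multiplicity_fun_def S fst_conv snd_conv eq by (rule plus_emeasure[symmetric]) auto
    moreover have "emeasure (count_space UNIV) (Some ` Y) = emeasure (count_space UNIV) Y" for Y :: "(real^'k) set"
      by (auto simp: emeasure_count_space card_image finite_image_iff inj_on_def)
    ultimately show ?thesis by (auto simp: indicator_def emeasure_count_space)
  qed
  then have "multiplicity_fun S = (\<lambda>y. emeasure (count_space UNIV) {v \<in> V. (g \<circ> Some) v = y}
      + indicator (if None \<in> \<omega> then {g None} else {}) y)" by auto
  then show ?thesis
    using borel_measurable_card_fibre[OF V h] by simp
qed

subsection \<open>Sets on which the mapping is nearly linear\<close>

text \<open>The set is an intersection over \<open>y\<close> of the alternatives
  \<open>r \<le> dist x y\<close> or \<open>F y x \<le> G y x\<close>. The strict inequality in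
  \<open>dist x y < r\<close> is what makes the first alternative closed.\<close>

lemma closedin_local_inequality:
  fixes F G :: "'b::metric_space \<Rightarrow> 'b \<Rightarrow> real"
  assumes F: "\<And>y. y \<in> D \<Longrightarrow> continuous_on D (F y)" and G: "\<And>y. y \<in> D \<Longrightarrow> continuous_on D (G y)"
  shows "closedin (top_of_set D) {x \<in> D. \<forall>y\<in>D. dist x y < r \<longrightarrow> F y x \<le> G y x}"
proof (cases "D = {}")
  case False
  have eq: "{x \<in> D. \<forall>y\<in>D. dist x y < r \<longrightarrow> F y x \<le> G y x}
      = (\<Inter>y\<in>D. {x \<in> D. r \<le> dist x y} \<union> {x \<in> D. F y x \<le> G y x})"
    using False by (auto dest: leD)
  have "closedin (top_of_set D) {x \<in> D. r \<le> dist x y}" for y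
  proof -
    have "{x \<in> D. r \<le> dist x y} = D \<inter> (\<lambda>x. dist x y) -` {r..}" by auto
    then show ?thesis by (simp add: continuous_closedin_preimage continuous_intros)
  qed
  moreover have "closedin (top_of_set D) {x \<in> D. F y x \<le> G y x}" if "y \<in> D" for y
  proof -
    have "{x \<in> D. F y x \<le> G y x} = D \<inter> (\<lambda>x. G y x - F y x) -` {0..}" by auto
    then show ?thesis
      using F[OF that] G[OF that] by (simp add: continuous_closedin_preimage continuous_intros)
  qed
  ultimately show ?thesis
    unfolding eq using False by (intro closedin_INT closedin_Un) auto
qed simp

lemma open_closedin_imp_borel:
  assumes "open U" "closedin (top_of_set U) Q"
  shows "Q \<in> sets borel"
proof -
  obtain C where "closed C" "Q = U \<inter> C" using assms(2) by (auto simp: closedin_closed)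
  then show ?thesis using assms(1) by auto
qed

text \<open>\<open>Q\<close> is a countable union of compact sets, hence so is its image. The image
  of a Borel part of \<open>Q\<close> is then a preimage under the continuous inverse.\<close>

lemma borel_image_injective:
  fixes f :: "'a::euclidean_space \<Rightarrow> 'b::t2_space" and g :: "'b \<Rightarrow> 'a"
  assumes U: "open U" and Q: "closedin (top_of_set U) Q" and f: "continuous_on U f"
    and g: "continuous_on (f ` Q) g" "\<And>x. x \<in> Q \<Longrightarrow> g (f x) = x"
    and B: "B \<in> sets borel"
  shows "f ` (Q \<inter> B) \<in> sets borel"
proof -
  obtain C where C: "closed C" "Q = U \<inter> C" using Q by (auto simp: closedin_closed)
  obtain K :: "nat \<Rightarrow> 'a set" where K: "\<And>n. compact (K n)" "\<And>n. K n \<subseteq> U" "(\<Union>n. K n) = U"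
    using open_Union_compact_subsets[OF U] by metis
  have "f ` Q = (\<Union>n. f ` (K n \<inter> C))" using C(2) K(3) by blast
  moreover have "compact (f ` (K n \<inter> C))" for n
    using K C(1) f by (intro compact_continuous_image compact_Int_closed) (auto intro: continuous_on_subset)
  then have "f ` (K n \<inter> C) \<in> sets borel" for n by (intro borel_closed compact_imp_closed)
  ultimately have fQ: "f ` Q \<in> sets borel" by auto
  have "g -` B \<inter> space (restrict_space borel (f ` Q)) \<in> sets (restrict_space borel (f ` Q))"
    using borel_measurable_continuous_on_restrict[OF g(1)] B by (rule measurable_sets)
  then have "g -` B \<inter> f ` Q \<in> sets borel"
    using fQ by (simp add: sets_restrict_space_iff space_restrict_space)
  moreover have "f ` (Q \<inter> B) = g -` B \<inter> f ` Q" using g(2) by auto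
  ultimately show ?thesis by simp
qed

text \<open>The linear map \<open>T\<close> is a parameter and not the derivative at
  \<open>x\<close>. For continuous \<open>f\<close> the set is therefore closed in \<open>D\<close>
  whether or not \<open>f\<close> is differentiable at its points, and countably many
  \<open>T\<close> can serve all derivatives.\<close>

definition near_affine_set ::
    "'a::real_normed_vector set \<Rightarrow> ('a \<Rightarrow> 'b::real_normed_vector) \<Rightarrow> ('a \<Rightarrow>\<^sub>L 'b) \<Rightarrow> real \<Rightarrow> real \<Rightarrow> 'a set" where
  "near_affine_set D f T e r =
     {x \<in> D. \<forall>y\<in>D. dist x y < r \<longrightarrow> norm (f y - f x - T (y - x)) \<le> e * norm (y - x)}"

definition expand_set ::
    "'a::real_normed_vector set \<Rightarrow> ('a \<Rightarrow> 'b::real_normed_vector) \<Rightarrow> real \<Rightarrow> real \<Rightarrow> 'a set" where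
  "expand_set D f c r = {x \<in> D. \<forall>y\<in>D. dist x y < r \<longrightarrow> norm (y - x) \<le> c * norm (f y - f x)}"

lemma closedin_near_affine_set:
  assumes "continuous_on D f"
  shows "closedin (top_of_set D) (near_affine_set D f T e r)"
  unfolding near_affine_set_def
  by (rule closedin_local_inequality[where F = "\<lambda>y x. norm (f y - f x - T (y - x))"])
    (intro continuous_intros assms)+

lemma closedin_expand_set:
  assumes "continuous_on D f"
  shows "closedin (top_of_set D) (expand_set D f c r)"
  unfolding expand_set_def
  by (rule closedin_local_inequality[where F = "\<lambda>y x. norm (y - x)"]) (intro continuous_intros assms)+

lemma near_affine_set_mono: "r' \<le> r \<Longrightarrow> near_affine_set D f T e r \<subseteq> near_affine_set D f T e r'"
  by (auto simp: near_affine_set_def)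

lemma expand_set_mono:
  assumes "r' \<le> r" "c \<le> c'" shows "expand_set D f c r \<subseteq> expand_set D f c' r'"
  unfolding expand_set_def using assms
  by (force intro: order_trans mult_right_mono)

text \<open>Both linear maps predict the same increment of \<open>f\<close>, with relative errors
  \<open>e\<close> and \<open>e'\<close>. As \<open>D\<close> is open, a short multiple of any
  direction can be tested.\<close>

lemma near_affine_set_unique:
  assumes D: "open D" and x: "x \<in> near_affine_set D f T e r" "x \<in> near_affine_set D f T' e' r'"
    and pos: "r > 0" "r' > 0" "e \<ge> 0" "e' \<ge> 0"
  shows "norm (T - T') \<le> e + e'"
proof (rule norm_blinfun_bound)
  fix h
  have xD: "x \<in> D" using x by (auto simp: near_affine_set_def)
  then obtain \<epsilon> where \<epsilon>: "\<epsilon> > 0" "ball x \<epsilon> \<subseteq> D" using D openE by blast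
  show "norm ((T - T') h) \<le> (e + e') * norm h"
  proof (cases "h = 0")
    case False
    \<comment> \<open>The step \<open>t *\<^sub>R h\<close> gets half the smallest of the three
      radii as its length, so the new point lies in \<open>D\<close> and within reach of both
      conditions.\<close>
    define t where "t = min \<epsilon> (min r r') / (2 * norm h)"
    have t: "t > 0" using \<epsilon> pos False by (simp add: t_def)
    let ?y = "x + t *\<^sub>R h"
    have "dist x ?y = min \<epsilon> (min r r') / 2" 
      using t False \<epsilon> pos by (simp add: dist_norm t_def abs_of_pos)
    then have y: "?y \<in> D" "dist x ?y < r" "dist x ?y < r'" using \<epsilon> pos by auto
    have "norm (T (t *\<^sub>R h) - T' (t *\<^sub>R h))
        = norm ((f ?y - f x - T' (t *\<^sub>R h)) - (f ?y - f x - T (t *\<^sub>R h)))" by simp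
    also have "\<dots> \<le> norm (f ?y - f x - T' (t *\<^sub>R h)) + norm (f ?y - f x - T (t *\<^sub>R h))"
      by (rule norm_triangle_ineq4)
    also have "\<dots> \<le> e' * norm (t *\<^sub>R h) + e * norm (t *\<^sub>R h)"
      using x y by (intro add_mono) (auto simp: near_affine_set_def)
    finally have "t * norm ((T - T') h) \<le> t * ((e + e') * norm h)"
      using t by (simp add: blinfun.scaleR_right blinfun.diff_left algebra_simps flip: scaleR_diff_right)
    then show ?thesis using t by simp
  qed simp
qed (use pos in simp)

lemma differentiable_imp_near_affine_set:
  assumes D: "x \<in> D" and f: "(f has_derivative blinfun_apply A) (at x)" and e: "norm (A - T) < e"
  shows "\<exists>r>0. x \<in> near_affine_set D f T e r"
proof -
  \<comment> \<open>The part of \<open>e\<close> not consumed by replacing \<open>A\<close> with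
    \<open>T\<close> is the error allowed to the derivative.\<close>
  let ?e = "e - norm (A - T)"
  obtain r where r: "r > 0" "\<And>y. norm (y - x) < r \<Longrightarrow> norm (f y - f x - A (y - x)) \<le> ?e * norm (y - x)"
    using f e unfolding has_derivative_at_alt by (metis diff_gt_0_iff_gt)
  have "norm (f y - f x - T (y - x)) \<le> e * norm (y - x)" if "dist x y < r" for y
  proof -
    have "norm (f y - f x - T (y - x)) = norm ((f y - f x - A (y - x)) + (A - T) (y - x))"
      by (simp add: blinfun.diff_left)
    also have "\<dots> \<le> ?e * norm (y - x) + norm (A - T) * norm (y - x)"
      using r(2)[of y] that by (intro norm_triangle_le add_mono norm_blinfun) (simp add: dist_norm norm_minus_commute)
    finally show ?thesis by (simp add: algebra_simps)
  qed
  then show ?thesis using r(1) D by (auto simp: near_affine_set_def)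
qed

text \<open>The derivative is itself an approximating map with arbitrarily small error, so
  \<open>near_affine_set_unique\<close> applies to it and \<open>T\<close>.\<close>

lemma derivative_near_near_affine_set:
  assumes D: "open D" and x: "x \<in> near_affine_set D f T e r" and "r > 0" "e \<ge> 0"
    and f: "(f has_derivative blinfun_apply A) (at x)"
  shows "norm (A - T) \<le> e"
proof (rule field_le_epsilon)
  fix e' :: real assume e': "e' > 0"
  have "x \<in> D" using x by (simp add: near_affine_set_def)
  then obtain r' where "r' > 0" "x \<in> near_affine_set D f A e' r'"
    using differentiable_imp_near_affine_set[OF _ f, of D A e'] e' by auto
  then show "norm (A - T) \<le> e + e'"
    using near_affine_set_unique[OF D _ x, of A e' r'] assms(3,4) e' by (simp add: add.commute)
qed

text \<open>The approximating maps are a Cauchy sequence by \<open>near_affine_set_unique\<close>,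
  and their limit is the derivative. Differentiability thus becomes a condition that does not
  mention the derivative, as \<open>borel_differentiable_set\<close> requires.\<close>

lemma near_affine_imp_differentiable:
  fixes f :: "'a::real_normed_vector \<Rightarrow> 'b::banach"
  assumes D: "open D" and x: "\<And>j::nat. \<exists>T. \<exists>r>0. x \<in> near_affine_set D f T (1 / (real j + 1)) r"
  shows "f differentiable (at x)"
proof -
  obtain T r where T: "\<And>j. r j > 0" "\<And>j. x \<in> near_affine_set D f (T j) (1 / (real j + 1)) (r j)"
    using x by metis
  have xD: "x \<in> D" using T(2)[of 0] by (simp add: near_affine_set_def)
  have d: "norm (T i - T j) \<le> 1 / (real i + 1) + 1 / (real j + 1)" for i j
    using near_affine_set_unique[OF D T(2) T(2) T(1) T(1), of i j] by simp
  have lim0: "(\<lambda>i. 1 / (real i + 1)) \<longlonglongrightarrow> 0"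
    using LIMSEQ_inverse_real_of_nat by (simp add: inverse_eq_divide add.commute)
  have "Cauchy T"
  proof (rule CauchyI)
    fix e :: real assume e: "e > 0"
    then have "eventually (\<lambda>i. 1 / (real i + 1) < e / 2) sequentially"
      using lim0 by (intro order_tendstoD(2)) auto
    then obtain M where "\<And>i. i \<ge> M \<Longrightarrow> 1 / (real i + 1) < e / 2" by (auto simp: eventually_sequentially)
    then show "\<exists>M. \<forall>m\<ge>M. \<forall>n\<ge>M. norm (T m - T n) < e"
      using d by (smt (verit) field_sum_of_halves)
  qed
  then obtain A where A: "T \<longlonglongrightarrow> A" using convergent_eq_Cauchy by blast
  have TA: "norm (A - T j) \<le> 1 / (real j + 1)" for j
  proof (rule tendsto_le[OF sequentially_bot])
    show "(\<lambda>i. norm (T i - T j)) \<longlonglongrightarrow> norm (A - T j)" by (intro tendsto_intros A)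
    show "(\<lambda>i. 1 / (real i + 1) + 1 / (real j + 1)) \<longlonglongrightarrow> 1 / (real j + 1)"
      using tendsto_add[OF lim0 tendsto_const] by simp
  qed (use d in auto)
  have "(f has_derivative blinfun_apply A) (at x)"
    unfolding has_derivative_at_alt
  proof (intro conjI allI impI)
    show "bounded_linear (blinfun_apply A)" by (rule blinfun.bounded_linear_right)
    fix e :: real assume "e > 0"
    then obtain j where "inverse (real (Suc j)) < e / 2" using reals_Archimedean[of "e / 2"] by auto
    then have j: "2 * (1 / (real j + 1)) < e" by (simp add: inverse_eq_divide add.commute)
    obtain \<epsilon> where \<epsilon>: "\<epsilon> > 0" "ball x \<epsilon> \<subseteq> D" using D xD openE by blast
    have "norm (f y - f x - A (y - x)) \<le> e * norm (y - x)" if y: "norm (y - x) < min \<epsilon> (r j)" for y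
    proof -
      have "y \<in> D" "dist x y < r j" using y \<epsilon> by (auto simp: dist_norm norm_minus_commute)
      then have "norm (f y - f x - T j (y - x)) \<le> 1 / (real j + 1) * norm (y - x)"
        using T(2)[of j] by (auto simp: near_affine_set_def)
      moreover have "norm ((A - T j) (y - x)) \<le> 1 / (real j + 1) * norm (y - x)"
        using norm_blinfun[of "A - T j" "y - x"] TA[of j] by (meson mult_right_mono norm_ge_zero order_trans)
      moreover have "f y - f x - A (y - x) = (f y - f x - T j (y - x)) - (A - T j) (y - x)"
        by (simp add: blinfun.diff_left)
      ultimately have "norm (f y - f x - A (y - x)) \<le> 1 / (real j + 1) * norm (y - x) + 1 / (real j + 1) * norm (y - x)"
        by (simp only: order_trans[OF norm_triangle_ineq4 add_mono])
      then have "norm (f y - f x - A (y - x)) \<le> 2 * (1 / (real j + 1)) * norm (y - x)"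
        by (simp add: distrib_right)
      also have "\<dots> \<le> e * norm (y - x)" using j by (intro mult_right_mono) auto
      finally show ?thesis .
    qed
    moreover have "min \<epsilon> (r j) > 0" using \<epsilon> T(1) by simp
    ultimately show "\<exists>d>0. \<forall>y. norm (y - x) < d \<longrightarrow> norm (f y - f x - A (y - x)) \<le> e * norm (y - x)" by blast
  qed
  then show ?thesis by (auto simp: differentiable_def)
qed

text \<open>One integer serves as expansion constant and as reciprocal radius, so a sequence of
  relatively closed sets catches all points of positive lower distortion when \<open>f\<close> is
  continuous.\<close>

lemma lower_distortion_pos_imp_expand_set:
  assumes x: "x \<in> D" and pos: "0 < lower_distortion D f x"
  shows "\<exists>m::nat. m > 0 \<and> x \<in> expand_set D f m (1 / m)"
proof -
  obtain c where c: "0 < c" "ereal c < lower_distortion D f x"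
    using pos ereal_dense2 by (metis ereal_less(2))
  from less_LiminfD[OF c(2)[unfolded lower_distortion_def]]
  obtain d where d: "d > 0" "\<And>y. y \<in> D \<Longrightarrow> y \<noteq> x \<Longrightarrow> dist y x < d \<Longrightarrow> c < norm (f x - f y) / norm (x - y)"
    by (auto simp: eventually_at)
  obtain m :: nat where m: "m > 0" "1 / c \<le> m" "1 / d \<le> m"
    using real_arch_simple[of "max 1 (max (1/c) (1/d))"] by (metis le_max_iff_disj max.bounded_iff of_nat_0_less_iff zero_less_one less_le_trans)
  have "norm (y - x) \<le> real m * norm (f y - f x)" if "y \<in> D" "dist x y < 1 / m" for y
  proof (cases "y = x")
    case False
    have "1 / m \<le> d" using m d(1) by (simp add: field_simps)
    then have "c < norm (f x - f y) / norm (x - y)" using d(2)[OF that(1) False] that(2) by (simp add: dist_commute)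
    then have "norm (x - y) \<le> 1 / c * norm (f x - f y)" using c False by (simp add: field_simps)
    also have "\<dots> \<le> m * norm (f x - f y)" using m by (intro mult_right_mono) auto
    finally show ?thesis by (simp add: norm_minus_commute)
  qed simp
  then show ?thesis using m x by (auto simp: expand_set_def)
qed

text \<open>Along a direction in the kernel the increment of \<open>f\<close> is of smaller order
  than the step, against the expansion inequality.\<close>

lemma inj_derivative_expand_set:
  assumes D: "open D" and x: "x \<in> expand_set D f c r" and r: "r > 0"
    and f: "(f has_derivative f') (at x)"
  shows "inj f'"
proof -
  have lin: "linear f'" using f by (rule has_derivative_linear)
  have xD: "x \<in> D" using x by (simp add: expand_set_def)
  then obtain \<epsilon> where \<epsilon>: "\<epsilon> > 0" "ball x \<epsilon> \<subseteq> D" using D openE by blast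
  have "h = 0" if h: "f' h = 0" for h
  proof (rule ccontr)
    assume "h \<noteq> 0"
    \<comment> \<open>Chosen so that \<open>\<bar>c\<bar> * e < 1\<close>; the sign of
      \<open>c\<close> is not prescribed.\<close>
    define e where "e = 1 / (2 * (\<bar>c\<bar> + 1))"
    have e: "e > 0" by (simp add: e_def add_nonneg_pos)
    obtain d where d: "d > 0" "\<And>y. norm (y - x) < d \<Longrightarrow> norm (f y - f x - f' (y - x)) \<le> e * norm (y - x)"
      using f e unfolding has_derivative_at_alt by blast
    define t where "t = min \<epsilon> (min r d) / (2 * norm h)"
    have t: "t > 0" using \<epsilon> r d \<open>h \<noteq> 0\<close> by (simp add: t_def)
    let ?y = "x + t *\<^sub>R h"
    have nt: "norm (t *\<^sub>R h) = min \<epsilon> (min r d) / 2"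
      using t \<open>h \<noteq> 0\<close> \<epsilon> r d by (simp add: t_def abs_of_pos)
    then have y: "?y \<in> D" "dist x ?y < r" "norm (?y - x) < d" using \<epsilon> r d by (auto simp: dist_norm)
    have "f' (t *\<^sub>R h) = 0" using h linear_scale[OF lin] by simp
    then have "norm (f ?y - f x) \<le> e * norm (t *\<^sub>R h)" using d(2)[OF y(3)] by simp
    moreover have "norm (t *\<^sub>R h) \<le> c * norm (f ?y - f x)" using x y by (auto simp: expand_set_def)
    ultimately have "norm (t *\<^sub>R h) \<le> \<bar>c\<bar> * (e * norm (t *\<^sub>R h))"
      by (smt (verit) mult_left_mono mult_right_mono norm_ge_zero)
    moreover have "\<bar>c\<bar> * e < 1" by (simp add: e_def field_simps)
    ultimately show False
      using t \<open>h \<noteq> 0\<close> mult_strict_right_mono[of "\<bar>c\<bar> * e" 1 "norm (t *\<^sub>R h)"] by (simp add: mult.assoc)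
  qed
  then show ?thesis using linear_injective_0[OF lin] by blast
qed

text \<open>Density is carried over from matrices by \<open>h\<close>, a continuous linear map onto
  the space of bounded linear maps.\<close>

lemma countable_dense_blinfun:
  "\<exists>\<T> :: ((real^'n) \<Rightarrow>\<^sub>L (real^'m::finite)) set. countable \<T> \<and> (\<forall>A e. e > 0 \<longrightarrow> (\<exists>T\<in>\<T>. norm (A - T) < e))"
proof -
  obtain \<M> :: "(real^'n^'m) set" where \<M>: "countable \<M>" "\<And>X. open X \<Longrightarrow> X \<noteq> {} \<Longrightarrow> \<exists>d\<in>\<M>. d \<in> X"
    by (rule countable_dense_setE) blast
  define h where "h M = Blinfun ((*v) M)" for M :: "real^'n^'m"
  have app: "blinfun_apply (h M) = (*v) M" for M
    unfolding h_def by (rule bounded_linear_Blinfun_apply) (rule matrix_vector_mul_bounded_linear)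
  have "linear h"
    by (rule linearI; rule blinfun_eqI)
      (simp_all add: app blinfun.add_left blinfun.scaleR_left matrix_vector_mult_add_rdistrib scaleR_matrix_vector_assoc)
  then have cont: "continuous_on UNIV h" by (intro linear_continuous_on) (simp add: linear_conv_bounded_linear)
  have "\<exists>T\<in>h ` \<M>. norm (A - T) < e" if "e > 0" for A e
  proof -
    have "h (matrix (blinfun_apply A)) = A"
      by (rule blinfun_eqI) (simp add: app matrix_works bounded_linear.linear blinfun.bounded_linear_right)
    then have "matrix (blinfun_apply A) \<in> h -` ball A e" using that by simp
    moreover have "open (h -` ball A e)" using cont by (simp add: open_vimage)
    ultimately obtain M where "M \<in> \<M>" "h M \<in> ball A e" using \<M>(2) by blast
    then show ?thesis by (auto simp: dist_norm)
  qed
  then show ?thesis using \<M>(1) by (intro exI[of _ "h ` \<M>"]) auto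
qed

lemma continuous_det_blinfun:
  "continuous_on UNIV (\<lambda>A :: (real^'n) \<Rightarrow>\<^sub>L (real^'n::finite). det (matrix (blinfun_apply A)))"
  unfolding det_def matrix_def by (simp, intro continuous_intros)

text \<open>
  The constants \<open>c\<close> and \<open>d\<close> stand for the norm and the Jacobian of the derivative. Nothing is asked
  of them where \<open>f\<close> is not differentiable, because the outer dilatation is infinite there.
\<close>

definition nearly_linear_on ::
    "real \<Rightarrow> (real^'n \<Rightarrow> real^'n::finite) \<Rightarrow> (real^'n) set \<Rightarrow> real \<Rightarrow> real \<Rightarrow> bool" where
  "nearly_linear_on s f Q c d \<longleftrightarrow>
     0 < c \<and> 0 < d \<and> Q \<in> sets borel \<and> bounded Q \<and>
     (\<forall>x\<in>Q. \<forall>y\<in>Q. dist (f x) (f y) \<le> c * dist x y) \<and>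
     (\<exists>K. \<forall>x\<in>Q. \<forall>y\<in>Q. dist x y \<le> K * dist (f x) (f y)) \<and>
     (\<forall>x\<in>Q. \<forall>f'. (f has_derivative f') (at x) \<longrightarrow>
        c \<le> (1 + s) * onorm f' \<and> \<bar>det (matrix f')\<bar> \<le> (1 + s) * d \<and> d \<le> (1 + s) * \<bar>det (matrix f')\<bar>) \<and>
     (\<forall>B\<in>sets borel. f ` (Q \<inter> B) \<in> sets borel)"

lemma dist_le_imp_continuous_inverse:
  fixes f :: "'a::metric_space \<Rightarrow> 'b::metric_space"
  assumes K: "\<And>x y. x \<in> Q \<Longrightarrow> y \<in> Q \<Longrightarrow> dist x y \<le> K * dist (f x) (f y)"
  shows "inj_on f Q" "continuous_on (f ` Q) (inv_into Q f)"
proof -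
  show inj: "inj_on f Q"
  proof (rule inj_onI)
    fix x y assume "x \<in> Q" "y \<in> Q" "f x = f y"
    then show "x = y" using K[of x y] by simp
  qed
  \<comment> \<open>A Lipschitz constant has to be nonnegative, whereas \<open>K\<close> may have
    any sign.\<close>
  have "dist x y \<le> \<bar>K\<bar> * dist (f x) (f y)" if "x \<in> Q" "y \<in> Q" for x y
    by (rule order_trans[OF K[OF that]]) (auto intro: mult_right_mono)
  then have "\<bar>K\<bar>-lipschitz_on (f ` Q) (inv_into Q f)"
    using inj by (intro lipschitz_onI) auto
  then show "continuous_on (f ` Q) (inv_into Q f)" by (rule lipschitz_on_continuous_on)
qed

text \<open>Any two points in a ball of radius \<open>1 / (2 * m)\<close> are closer than
  \<open>1 / m\<close>, so the local expansion inequality holds between all points of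
  \<open>Q\<close> and makes the inverse Lipschitz.\<close>

lemma borel_image_expand_set:
  fixes f :: "'a::euclidean_space \<Rightarrow> 'b::euclidean_space"
  assumes D: "open D" and f: "continuous_on D f" and m: "m > 0"
    and Q: "closedin (top_of_set (D \<inter> ball z (1 / (2 * m)))) Q" "Q \<subseteq> expand_set D f m (1 / m)"
  shows "\<And>B. B \<in> sets borel \<Longrightarrow> f ` (Q \<inter> B) \<in> sets borel"
    and "\<And>x y. x \<in> Q \<Longrightarrow> y \<in> Q \<Longrightarrow> dist x y \<le> m * dist (f x) (f y)"
proof -
  let ?U = "D \<inter> ball z (1 / (2 * m))"
  have QU: "Q \<subseteq> ?U" using Q(1) closedin_imp_subset by blast
  show K: "dist x y \<le> m * dist (f x) (f y)" if "x \<in> Q" "y \<in> Q" for x y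
  proof -
    have "dist z x < 1 / (2 * m)" "dist z y < 1 / (2 * m)" "y \<in> D" using that QU by auto
    then have "dist x y < 1 / (2 * m) + 1 / (2 * m)"
      using dist_triangle[of x y z] by (simp add: dist_commute)
    then have "dist x y < 1 / m" using m by simp
    then show ?thesis
      using that \<open>y \<in> D\<close> Q(2) unfolding expand_set_def by (auto simp: dist_norm norm_minus_commute)
  qed
  show "f ` (Q \<inter> B) \<in> sets borel" if "B \<in> sets borel" for B
  proof (rule borel_image_injective[OF _ Q(1) _ _ _ that])
    show "open ?U" using D by auto
    show "continuous_on ?U f" using f by (rule continuous_on_subset) auto
    show "continuous_on (f ` Q) (inv_into Q f)" by (rule dist_le_imp_continuous_inverse[OF K])
    show "inv_into Q f (f x) = x" if "x \<in> Q" for x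
      using that dist_le_imp_continuous_inverse(1)[OF K] by simp
  qed
qed

text \<open>A piece is given by a linear map \<open>T\<close> from a countable dense set, an error,
  a scale and a centre. Its constants are \<open>norm T\<close> plus the error, and the absolute
  determinant of \<open>T\<close>. A point of the set to be covered is caught by taking
  \<open>T\<close> close to the derivative there, which is invertible.\<close>

lemma nearly_linear_cover:
  fixes f :: "real^'n \<Rightarrow> real^'n::finite"
  assumes D: "open D" and f: "continuous_on D f" and s: "s > 0"
  shows "\<exists>\<Q>. countable \<Q> \<and> (\<forall>Q\<in>\<Q>. \<exists>c d. nearly_linear_on s f Q c d \<and> Q \<subseteq> D) \<and>
    (\<forall>x\<in>D. f differentiable (at x) \<and> 0 < lower_distortion D f x \<longrightarrow> x \<in> \<Union>\<Q>)"
proof -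
  obtain \<T> :: "((real^'n) \<Rightarrow>\<^sub>L (real^'n)) set"
    where \<T>: "countable \<T>" "\<And>A e. e > 0 \<Longrightarrow> \<exists>T\<in>\<T>. norm (A - T) < e"
    using countable_dense_blinfun by blast
  obtain Z :: "(real^'n) set" where Z: "countable Z" "\<And>X. open X \<Longrightarrow> X \<noteq> {} \<Longrightarrow> \<exists>d\<in>Z. d \<in> X"
    by (rule countable_dense_setE) blast
  let ?det = "\<lambda>A :: (real^'n) \<Rightarrow>\<^sub>L (real^'n). \<bar>det (matrix (blinfun_apply A))\<bar>"
  define good where "good T e \<longleftrightarrow> ?det T > 0 \<and> (\<forall>A. norm (A - T) \<le> e \<longrightarrow>
      norm T + e \<le> (1 + s) * norm A \<and> ?det A \<le> (1 + s) * ?det T \<and> ?det T \<le> (1 + s) * ?det A)" for T e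
  define piece where "piece = (\<lambda>(T, j::nat, m::nat, z). near_affine_set D f T (1 / (real j + 1)) (1 / real m)
      \<inter> expand_set D f m (1 / real m) \<inter> ball z (1 / (2 * real m)))"
  define I where "I = {(T, j, m, z). T \<in> \<T> \<and> z \<in> Z \<and> (m::nat) > 0 \<and> good T (1 / (real (j::nat) + 1))}"
  have "countable (\<T> \<times> (UNIV :: nat set) \<times> (UNIV :: nat set) \<times> Z)" using \<T>(1) Z(1) by auto
  then have cI: "countable I" by (rule countable_subset[rotated]) (auto simp: I_def)
  have nl: "\<exists>c d. nearly_linear_on s f (piece i) c d \<and> piece i \<subseteq> D" if "i \<in> I" for i
  proof -
    obtain T j m z where i: "i = (T, j, m, z)" by (cases i)
    have m: "m > 0" and good: "good T (1 / (real j + 1))" using that by (auto simp: I_def i)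
    let ?e = "1 / (real j + 1)" let ?U = "D \<inter> ball z (1 / (2 * real m))"
    have pD: "piece i \<subseteq> ?U" by (auto simp: piece_def i near_affine_set_def)
    have "piece i = ?U \<inter> (near_affine_set D f T ?e (1 / real m) \<inter> expand_set D f m (1 / real m))"
      using pD by (auto simp: piece_def i)
    moreover have "closedin (top_of_set D) (near_affine_set D f T ?e (1 / real m) \<inter> expand_set D f m (1 / real m))"
      by (intro closedin_Int closedin_near_affine_set closedin_expand_set f)
    then obtain C where "closed C"
        "near_affine_set D f T ?e (1 / real m) \<inter> expand_set D f m (1 / real m) = D \<inter> C"
      by (auto simp: closedin_closed)
    ultimately have "piece i = ?U \<inter> C" "closed C" by auto
    then have cl: "closedin (top_of_set ?U) (piece i)" by (auto simp: closedin_closed)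
    have ex: "piece i \<subseteq> expand_set D f m (1 / real m)" by (auto simp: piece_def i)
    note img = borel_image_expand_set[OF D f _ cl ex]
    have lip: "dist (f x) (f y) \<le> (norm T + ?e) * dist x y" if "x \<in> piece i" "y \<in> piece i" for x y
    proof -
      have "dist z x < 1 / (2 * m)" "dist z y < 1 / (2 * m)" "y \<in> D" using that pD by auto
      then have "dist x y < 1 / (2 * m) + 1 / (2 * m)"
        using dist_triangle[of x y z] by (simp add: dist_commute)
      then have "dist x y < 1 / m" using m by simp
      then have "norm (f y - f x - T (y - x)) \<le> ?e * norm (y - x)"
        using that(1) \<open>y \<in> D\<close> by (auto simp: piece_def i near_affine_set_def)
      moreover have "norm (f y - f x) \<le> norm (T (y - x)) + norm (f y - f x - T (y - x))"
        using norm_triangle_ineq[of "T (y - x)" "f y - f x - T (y - x)"] by simp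
      moreover have "norm (T (y - x)) \<le> norm T * norm (y - x)" by (rule norm_blinfun)
      ultimately have "norm (f y - f x) \<le> norm T * norm (y - x) + ?e * norm (y - x)" by linarith
      then show ?thesis by (simp add: dist_norm norm_minus_commute distrib_right)
    qed
    have "nearly_linear_on s f (piece i) (norm T + ?e) (?det T)"
      unfolding nearly_linear_on_def
    proof (intro conjI ballI allI impI)
      show "0 < norm T + ?e" by (intro add_nonneg_pos) auto
      show "0 < ?det T" using good by (simp add: good_def)
      show "piece i \<in> sets borel" using D cl by (intro open_closedin_imp_borel[of ?U]) auto
      show "bounded (piece i)" using pD by (meson bounded_ball bounded_subset inf.boundedE)
      show "\<exists>K. \<forall>x\<in>piece i. \<forall>y\<in>piece i. dist x y \<le> K * dist (f x) (f y)"
        using img(2) m by (intro exI[of _ "real m"]) auto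
      show "f ` (piece i \<inter> B) \<in> sets borel" if "B \<in> sets borel" for B using img(1) m that by simp
      fix x f' assume x: "x \<in> piece i" and f': "(f has_derivative f') (at x)"
      have bl: "bounded_linear f'" using f' by (rule has_derivative_bounded_linear)
      define A where "A = Blinfun f'"
      have A: "blinfun_apply A = f'" unfolding A_def by (rule bounded_linear_Blinfun_apply[OF bl])
      have "norm (A - T) \<le> ?e"
        using x m f' by (intro derivative_near_near_affine_set[OF D, of x f T ?e "1 / real m"])
          (auto simp: piece_def i A)
      then have "norm T + ?e \<le> (1 + s) * norm A \<and> ?det A \<le> (1 + s) * ?det T \<and> ?det T \<le> (1 + s) * ?det A"
        using good unfolding good_def by blast
      then show "norm T + ?e \<le> (1 + s) * onorm f'" "\<bar>det (matrix f')\<bar> \<le> (1 + s) * ?det T"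
          "?det T \<le> (1 + s) * \<bar>det (matrix f')\<bar>"
        by (auto simp: norm_blinfun.rep_eq A)
    qed (use lip in auto)
    then show ?thesis using pD by blast
  qed
  have cover: "x \<in> \<Union> (piece ` I)"
    if x: "x \<in> D" and diff: "f differentiable (at x)" and pos: "0 < lower_distortion D f x" for x
  proof -
    obtain f' where f': "(f has_derivative f') (at x)" using diff by (auto simp: differentiable_def)
    have bl: "bounded_linear f'" using f' by (rule has_derivative_bounded_linear)
    define A where "A = Blinfun f'"
    have A: "blinfun_apply A = f'" unfolding A_def by (rule bounded_linear_Blinfun_apply[OF bl])
    obtain m0 :: nat where m0: "m0 > 0" "x \<in> expand_set D f m0 (1 / real m0)"
      using lower_distortion_pos_imp_expand_set[OF x pos] by auto
    have "inj f'" using inj_derivative_expand_set[OF D m0(2) _ f'] m0(1) by simp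
    then have detA: "?det A > 0"
      using det_nz_iff_inj[OF has_derivative_linear[OF f']] by (simp add: A)
    have "A \<noteq> 0"
    proof
      assume "A = 0"
      then have "f' 0 = f' (axis undefined 1)" by (simp add: A[symmetric])
      then have "(0 :: real^'n) = axis undefined 1" using \<open>inj f'\<close> by (rule injD[rotated])
      then show False by (metis axis_eq_0_iff zero_neq_one)
    qed
    \<comment> \<open>The determinants of \<open>A'\<close> and \<open>T\<close> are both compared
      with that of \<open>A\<close>; each comparison costs a factor \<open>q\<close>, together
      \<open>1 + s\<close>.\<close>
    define q where "q = sqrt (1 + s)"
    have q: "q > 1" "q * q = 1 + s" using s by (auto simp: q_def)
    have "isCont ?det A"
      using continuous_on_rabs[OF continuous_det_blinfun[where 'n='n]] by (simp add: continuous_on_eq_continuous_at)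
    then have lim: "(?det \<longlongrightarrow> ?det A) (nhds A)"
      unfolding isCont_def tendsto_at_iff_tendsto_nhds[of ?det] .
    have "?det A / q < ?det A" "?det A < ?det A * q" using detA q by (auto simp: divide_less_eq)
    then have "eventually (\<lambda>A'. ?det A / q < ?det A' \<and> ?det A' < ?det A * q) (nhds A)"
      by (intro eventually_conj order_tendstoD[OF lim])
    then obtain \<eta> where \<eta>: "\<eta> > 0" "\<And>A'. norm (A' - A) < \<eta> \<Longrightarrow> ?det A / q < ?det A' \<and> ?det A' < ?det A * q"
      unfolding eventually_nhds_metric by (auto simp: dist_norm)
    \<comment> \<open>With \<open>e = 1 / (j + 1)\<close>, the first bound gives
      \<open>2 * e < \<eta>\<close>, as \<open>A'\<close> is within \<open>2 * e\<close> of
      \<open>A\<close>. The second makes the norm errors \<open>2 * e + (1 + s) * (2 * e)\<close>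
      fit into \<open>s * norm A\<close>.\<close>
    obtain j where "inverse (real (Suc j)) < min (\<eta> / 2) (s * norm A / (2 * (3 + s)))"
      using reals_Archimedean[of "min (\<eta> / 2) (s * norm A / (2 * (3 + s)))"] \<eta>(1) s \<open>A \<noteq> 0\<close> by auto
    then have j: "2 * (1 / (real j + 1)) < \<eta>" "2 * (3 + s) * (1 / (real j + 1)) < s * norm A"
      using s by (auto simp: inverse_eq_divide field_simps)
    let ?e = "1 / (real j + 1)"
    obtain T where T: "T \<in> \<T>" "norm (A - T) < ?e" using \<T>(2)[of ?e] by auto
    have good: "good T ?e"
      unfolding good_def
    proof (intro conjI allI impI)
      have e0: "?e > 0" by simp
      have "norm (T - A) < \<eta>" using T(2) j(1) e0 norm_minus_commute[of T A] by linarith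
      note dT = \<eta>(2)[OF this]
      then show "?det T > 0" using detA q by (meson divide_pos_pos less_trans zero_less_one)
      fix A' assume A': "norm (A' - T) \<le> ?e"
      have AA: "norm (A' - A) < 2 * ?e"
        using A' T(2) norm_triangle_ineq4[of "A' - T" "A - T"] by simp
      then have dA': "?det A / q < ?det A'" "?det A' < ?det A * q" using \<eta>(2)[of A'] j(1) by auto
      have "?det A < ?det A' * q" "?det A < ?det T * q" using dA' dT q by (auto simp: divide_simps)
      then have "?det T < ?det A' * q * q" "?det A' < ?det T * q * q"
        using dT dA' q by (meson less_trans mult_strict_right_mono zero_less_one)+
      then show "?det A' \<le> (1 + s) * ?det T" "?det T \<le> (1 + s) * ?det A'"
        unfolding q(2)[symmetric] by (simp_all add: mult_ac)
      have "norm T \<le> norm A + ?e" using T(2) norm_triangle_ineq2[of T A] norm_minus_commute[of T A] by linarith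
      moreover have "norm A \<le> norm A' + 2 * ?e" using AA norm_triangle_ineq2[of A A'] norm_minus_commute[of A A'] by linarith
      then have "(1 + s) * norm A \<le> (1 + s) * (norm A' + 2 * ?e)" using s by (intro mult_left_mono) auto
      moreover have "norm A + 2 * ?e + (1 + s) * (2 * ?e) \<le> (1 + s) * norm A"
      proof -
        have "2 * a + (1 + s) * (2 * a) = 2 * (2 + s) * a" for a by (simp add: algebra_simps)
        then have "2 * ?e + (1 + s) * (2 * ?e) = 2 * (2 + s) * ?e" .
        also have "\<dots> \<le> 2 * (3 + s) * ?e" by (intro mult_right_mono) auto
        finally have "2 * ?e + (1 + s) * (2 * ?e) \<le> s * norm A" using j(2) by linarith
        moreover have "(1 + s) * norm A = norm A + s * norm A" by (simp add: distrib_right)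
        ultimately show ?thesis by linarith
      qed
      moreover have "(1 + s) * (norm A' + 2 * ?e) = (1 + s) * norm A' + (1 + s) * (2 * ?e)"
        by (rule distrib_left)
      ultimately show "norm T + ?e \<le> (1 + s) * norm A'" by linarith
    qed
    obtain r where r: "r > 0" "x \<in> near_affine_set D f T ?e r"
      using differentiable_imp_near_affine_set[OF x _ T(2)] f' A by auto
    obtain m1 :: nat where "1 / r \<le> m1" using real_arch_simple by blast
    \<comment> \<open>A single scale has to suit both conditions: the radius falls below
      \<open>r\<close> and \<open>1 / m0\<close>, and the expansion constant does not fall below
      \<open>m0\<close>.\<close>
    define m where "m = max m0 (Suc m1)"
    have m: "m > 0" "real m0 \<le> real m" "1 / real m \<le> 1 / real m0" "1 / real m \<le> r"
    proof -
      show "m > 0" "real m0 \<le> real m" "1 / real m \<le> 1 / real m0" using m0(1) by (auto simp: m_def divide_simps)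
      have "1 / r \<le> real m" using \<open>1 / r \<le> m1\<close> by (simp add: m_def)
      then show "1 / real m \<le> r" using r(1) \<open>m > 0\<close> by (simp add: field_simps)
    qed
    obtain z where z: "z \<in> Z" "z \<in> ball x (1 / (2 * real m))"
      using Z(2)[of "ball x (1 / (2 * real m))"] m(1) by auto
    have "(T, j, m, z) \<in> I" using T(1) z(1) m(1) good by (simp add: I_def)
    moreover have "x \<in> piece (T, j, m, z)"
      using subsetD[OF near_affine_set_mono[OF m(4)] r(2)] subsetD[OF expand_set_mono[OF m(3,2)] m0(2)] z(2)
      by (auto simp: piece_def dist_commute)
    ultimately show ?thesis by blast
  qed
  show ?thesis
    using cI nl cover by (intro exI[of _ "piece ` I"]) auto
qed

text \<open>For every error \<open>1 / (j + 1)\<close> some \<open>T\<close> from a countable dense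
  set must approximate at some radius \<open>1 / (m + 1)\<close>; these are countable operations on
  relatively closed sets.\<close>

lemma borel_differentiable_set:
  fixes f :: "real^'n \<Rightarrow> real^'m::finite"
  assumes D: "open D" and f: "continuous_on D f"
  shows "{x \<in> D. f differentiable (at x)} \<in> sets borel"
proof -
  obtain \<T> :: "((real^'n) \<Rightarrow>\<^sub>L (real^'m)) set"
    where \<T>: "countable \<T>" "\<And>A e. e > 0 \<Longrightarrow> \<exists>T\<in>\<T>. norm (A - T) < e"
    using countable_dense_blinfun by blast
  have "x \<in> D \<and> f differentiable (at x) \<longleftrightarrow>
      (\<forall>j::nat. \<exists>T\<in>\<T>. \<exists>m::nat. x \<in> near_affine_set D f T (1 / (real j + 1)) (1 / (real m + 1)))" for x
  proof safe
    fix j :: nat assume x: "x \<in> D" and "f differentiable (at x)"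
    then obtain f' where f': "(f has_derivative f') (at x)" by (auto simp: differentiable_def)
    define A where "A = Blinfun f'"
    have A: "blinfun_apply A = f'"
      unfolding A_def using f' by (intro bounded_linear_Blinfun_apply has_derivative_bounded_linear)
    obtain T where T: "T \<in> \<T>" "norm (A - T) < 1 / (real j + 1)" using \<T>(2)[of "1 / (real j + 1)"] by auto
    obtain r where r: "r > 0" "x \<in> near_affine_set D f T (1 / (real j + 1)) r"
      using differentiable_imp_near_affine_set[OF x _ T(2)] f' A by auto
    obtain m where "inverse (real (Suc m)) < r" using reals_Archimedean[OF r(1)] by auto
    then have "1 / (real m + 1) \<le> r" by (simp add: inverse_eq_divide add.commute)
    then show "\<exists>T\<in>\<T>. \<exists>m::nat. x \<in> near_affine_set D f T (1 / (real j + 1)) (1 / (real m + 1))"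
      using r(2) T(1) near_affine_set_mono by blast
  next
    assume H: "\<forall>j::nat. \<exists>T\<in>\<T>. \<exists>m::nat. x \<in> near_affine_set D f T (1 / (real j + 1)) (1 / (real m + 1))"
    then show "x \<in> D" by (auto simp: near_affine_set_def)
    show "f differentiable (at x)"
    proof (rule near_affine_imp_differentiable[OF D])
      fix j :: nat
      obtain T and m :: nat where "x \<in> near_affine_set D f T (1 / (real j + 1)) (1 / (real m + 1))" using H by blast
      then show "\<exists>T. \<exists>r>0. x \<in> near_affine_set D f T (1 / (real j + 1)) r"
        by (intro exI[of _ T] exI[of _ "1 / (real m + 1)"]) auto
    qed
  qed
  then have "{x \<in> D. f differentiable (at x)} =
      (\<Inter>j::nat. \<Union>T\<in>\<T>. \<Union>m::nat. near_affine_set D f T (1 / (real j + 1)) (1 / (real m + 1)))"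
    by (simp add: set_eq_iff)
  moreover have "near_affine_set D f T e r \<in> sets borel" for T e r
    using open_closedin_imp_borel[OF D closedin_near_affine_set[OF f]] .
  ultimately show ?thesis using \<T>(1) by (auto intro!: sets.countable_INT sets.countable_UN' sets.countable_UN)
qed

subsection \<open>Powers and dilatations\<close>

lemma ennreal_powr_0 [simp]: "ennreal_powr 0 p = 0"
  by (simp add: ennreal_powr_def)

lemma ennreal_powr_eq_0_iff: "ennreal_powr x p = 0 \<longleftrightarrow> x = 0"
  by (cases x) (auto simp: ennreal_powr_def)

lemma borel_measurable_ennreal_powr [measurable]: "(\<lambda>x. ennreal_powr x p) \<in> borel_measurable borel"
  unfolding ennreal_powr_def by measurable

lemma ennreal_powr_mult:
  assumes "c > 0" shows "ennreal_powr (ennreal c * x) p = ennreal (c powr p) * ennreal_powr x p"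
  using assms
  by (cases x) (auto simp: ennreal_powr_def ennreal_mult_top powr_mult ennreal_mult simp flip: ennreal_mult)

text \<open>This is why the test function joins its densities by \<open>max\<close>: the power of a
  sum would in general bring in a constant depending on \<open>p\<close>.\<close>

lemma ennreal_powr_max_le: "ennreal_powr (max x y) p \<le> ennreal_powr x p + ennreal_powr y p"
  by (auto simp: max_def)

lemma sum_outer_dilatation_le_inner:
  assumes "finite X" "X \<subseteq> {x \<in> E. f x = y}"
  shows "(\<Sum>x\<in>X. outer_dilatation p f x) \<le> inner_dilatation_inverse p f E y"
  unfolding inner_dilatation_inverse_def
  using assms by (subst nonneg_infsum_complete) (auto intro: SUP_upper)

text \<open>Outside \<open>D\<close> the values of \<open>f\<close> are arbitrary, so the
  composition is cut off before it is treated as a Borel function on the whole space.\<close>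

lemma borel_measurable_comp_indicator:
  fixes \<rho> :: "'b::topological_space \<Rightarrow> ennreal"
  assumes D: "open D" and f: "continuous_on D f" and \<rho>: "\<rho> \<in> borel_measurable borel"
    and E: "E \<in> sets borel" "E \<subseteq> D"
  shows "(\<lambda>x. \<rho> (f x) * indicator E x) \<in> borel_measurable borel"
proof -
  have "f \<in> borel_measurable (restrict_space borel E)"
    using f E(2) by (intro borel_measurable_continuous_on_restrict) (rule continuous_on_subset)
  then have "(\<lambda>x. \<rho> (f x)) \<in> borel_measurable (restrict_space borel E)"
    using \<rho> by (rule measurable_compose)
  then show ?thesis using E(1) by (simp add: borel_measurable_restrict_space_iff_ennreal)
qed

lemma measurable_restrict_space_superset:
  assumes "f \<in> measurable (restrict_space borel P) L" "sets borel \<subseteq> sets M" "space M = UNIV"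
  shows "f \<in> measurable (restrict_space M P) L"
proof -
  have "(\<lambda>x. x) \<in> measurable M borel" using assms(2,3) by (auto simp: measurable_def)
  then have "(\<lambda>x. x) \<in> measurable (restrict_space M P) (restrict_space borel P)"
    by (rule measurable_restrict_space3) auto
  from measurable_compose[OF this assms(1)] show ?thesis .
qed

section \<open>Points of nondifferentiability when the right-hand side is finite\<close>

lemma null_nondifferentiability_set:
  fixes f :: "real^'n \<Rightarrow> real^'n::finite"
  assumes D: "open D" and f: "continuous_on D f" and E: "E \<in> sets borel" "E \<subseteq> D"
    and \<rho>: "\<rho> \<in> borel_measurable borel"
    and fin: "(\<integral>\<^sup>+ y\<in>f ` E. (inner_dilatation_inverse p f E y * ennreal_powr (\<rho> y) p) \<partial>lebesgue) < \<infinity>"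
  shows "negligible {x \<in> E. \<not> f differentiable (at x) \<and> 0 < lower_distortion D f x \<and> \<rho> (f x) \<noteq> 0}"
proof -
  \<comment> \<open>The condition on the lower distortion is left out to have a Borel set; it
    returns through the sets \<open>Q m z\<close>.\<close>
  define A where "A = {x \<in> E. \<not> f differentiable (at x) \<and> \<rho> (f x) \<noteq> 0}"
  have A: "A \<in> sets borel"
  proof -
    have "A = (E - {x \<in> D. f differentiable (at x)}) \<inter> {x. \<rho> (f x) * indicator E x \<noteq> 0}"
      using E by (auto simp: A_def)
    moreover have "{x. \<rho> (f x) * indicator E x \<noteq> 0} \<in> sets borel"
      using borel_measurable_comp_indicator[OF D f \<rho> E] by measurable
    ultimately show ?thesis using borel_differentiable_set[OF D f] E by auto
  qed
  obtain Z :: "(real^'n) set" where Z: "countable Z" "\<And>X. open X \<Longrightarrow> X \<noteq> {} \<Longrightarrow> \<exists>d\<in>Z. d \<in> X"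
    by (rule countable_dense_setE) blast
  define Q where "Q m z = expand_set D f (real m) (1 / real m) \<inter> ball z (1 / (2 * real m))" for m :: nat and z
  have neg: "negligible (Q m z \<inter> A)" if m: "m > 0" for m z
  proof -
    have QD: "Q m z \<subseteq> D" by (auto simp: Q_def expand_set_def)
    obtain C where C: "closed C" "expand_set D f (real m) (1 / real m) = D \<inter> C"
      using closedin_expand_set[OF f, of "real m" "1 / real m"] by (auto simp: closedin_closed)
    have "Q m z = (D \<inter> ball z (1 / (2 * real m))) \<inter> C" using C by (auto simp: Q_def)
    then have cl: "closedin (top_of_set (D \<inter> ball z (1 / (2 * real m)))) (Q m z)"
      using C by (auto simp: closedin_closed)
    have sub: "Q m z \<subseteq> expand_set D f (real m) (1 / real m)" by (auto simp: Q_def)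
    have m': "real m > 0" using m by simp
    note img = borel_image_expand_set[OF D f m' cl sub]
    let ?W = "f ` (Q m z \<inter> A)"
    have W: "?W \<in> sets borel" using img(1)[OF A] .
    \<comment> \<open>One point with infinite dilatation makes the whole fibre sum infinite, and
      \<rho> does not vanish on \<open>?W\<close>. Finiteness of the integral therefore forces
      measure 0.\<close>
    have "\<infinity> * emeasure lebesgue ?W = (\<integral>\<^sup>+ y. \<infinity> * indicator ?W y \<partial>lebesgue)"
      using W by (subst nn_integral_cmult_indicator) auto
    also have "\<dots> \<le> (\<integral>\<^sup>+ y\<in>f ` E. (inner_dilatation_inverse p f E y * ennreal_powr (\<rho> y) p) \<partial>lebesgue)"
    proof (rule nn_integral_mono)
      fix y
      show "\<infinity> * indicator ?W y \<le> inner_dilatation_inverse p f E y * ennreal_powr (\<rho> y) p * indicator (f ` E) y"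
      proof (cases "y \<in> ?W")
        case True
        then obtain x where x: "x \<in> A" "y = f x" by blast
        then have xE: "x \<in> E" "\<rho> y \<noteq> 0" by (auto simp: A_def)
        have "outer_dilatation p f x = \<infinity>" using x by (simp add: outer_dilatation_def A_def)
        then have "inner_dilatation_inverse p f E y = \<infinity>"
          using sum_outer_dilatation_le_inner[of "{x}" E f y p] x xE by (simp add: top_unique)
        then show ?thesis
          using x xE by (simp add: ennreal_powr_eq_0_iff ennreal_top_mult)
      qed simp
    qed
    also have "\<dots> < \<infinity>" by (rule fin)
    finally have "emeasure lebesgue ?W = 0" by (auto simp: ennreal_top_mult split: if_splits)
    then have negW: "negligible ?W" using W by (simp add: negligible_iff_null_sets null_sets_def)
    let ?g = "inv_into (Q m z) f"
    have inj: "inj_on f (Q m z)" by (rule dist_le_imp_continuous_inverse(1)[OF img(2)])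
    have "negligible (?g ` ?W)"
    proof (rule negligible_locally_Lipschitz_image[OF _ negW])
      fix u assume "u \<in> ?W"
      then have "\<forall>v\<in>?W \<inter> UNIV. norm (?g v - ?g u) \<le> real m * norm (v - u)"
        using img(2) inj by (auto simp: dist_norm)
      then show "\<exists>T B. open T \<and> u \<in> T \<and> (\<forall>v\<in>?W \<inter> T. norm (?g v - ?g u) \<le> B * norm (v - u))"
        by (intro exI[of _ UNIV] exI[of _ "real m"]) auto
    qed simp
    moreover have "?g ` ?W = Q m z \<inter> A" using inj by (auto simp: image_iff intro!: bexI)
    ultimately show ?thesis by simp
  qed
  have "{x \<in> E. \<not> f differentiable (at x) \<and> 0 < lower_distortion D f x \<and> \<rho> (f x) \<noteq> 0}
      \<subseteq> (\<Union>i\<in>{0<..} \<times> Z. Q (fst i) (snd i) \<inter> A)"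
  proof
    fix x assume x: "x \<in> {x \<in> E. \<not> f differentiable (at x) \<and> 0 < lower_distortion D f x \<and> \<rho> (f x) \<noteq> 0}"
    then obtain m :: nat where m: "m > 0" "x \<in> expand_set D f (real m) (1 / real m)"
      using lower_distortion_pos_imp_expand_set[of x D f] E by auto
    obtain z where z: "z \<in> Z" "z \<in> ball x (1 / (2 * real m))"
      using Z(2)[of "ball x (1 / (2 * real m))"] m(1) by auto
    have "x \<in> Q m z \<inter> A" using m z x by (auto simp: Q_def A_def dist_commute)
    then show "x \<in> (\<Union>i\<in>{0<..} \<times> Z. Q (fst i) (snd i) \<inter> A)" using m z by (auto simp del: UN_simps intro!: bexI[of _ "(m, z)"])
  qed
  moreover have "negligible (\<Union>i\<in>{0<..} \<times> Z. Q (fst i) (snd i) \<inter> A)"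
    using neg Z(1) by (intro negligible_countable_Union) (auto simp del: UN_simps)
  ultimately show ?thesis by (rule negligible_subset[rotated])
qed

text \<open>A constant \<open>\<kappa>\<close> below the outer dilatation keeps the right-hand
  integrand Borel and can later be summed over the points of a fibre.\<close>

lemma nearly_linear_volume_le:
  fixes f :: "real^'n \<Rightarrow> real^'n::finite"
  assumes nl: "nearly_linear_on s f Q c d" and s: "s > 0" and P: "P \<subseteq> Q" "P \<in> sets borel"
    and D: "open D" "continuous_on D f" "P \<subseteq> D"
    and diff: "\<And>x. x \<in> P \<Longrightarrow> f differentiable (at x)" and \<rho>: "\<rho> \<in> borel_measurable borel" and p: "p > 0"
  shows "\<exists>\<kappa>. (\<forall>x\<in>P. \<kappa> \<le> outer_dilatation p f x) \<and>
    (\<integral>\<^sup>+ x\<in>P. ennreal_powr (ennreal c * \<rho> (f x)) p \<partial>lebesgue)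
      \<le> ennreal ((1 + s) powr (p + 2)) * (\<integral>\<^sup>+ y\<in>f ` P. \<kappa> * ennreal_powr (\<rho> y) p \<partial>lebesgue)"
proof -
  have c: "c > 0" and d: "d > 0" and img: "\<And>B. B \<in> sets borel \<Longrightarrow> f ` (Q \<inter> B) \<in> sets borel"
    and K: "\<exists>K. \<forall>x\<in>Q. \<forall>y\<in>Q. dist x y \<le> K * dist (f x) (f y)"
    and bd: "bounded Q"
    and der: "\<And>x f'. x \<in> Q \<Longrightarrow> (f has_derivative f') (at x) \<Longrightarrow> c \<le> (1 + s) * onorm f' \<and>
      \<bar>det (matrix f')\<bar> \<le> (1 + s) * d \<and> d \<le> (1 + s) * \<bar>det (matrix f')\<bar>"
    using nl by (auto simp: nearly_linear_on_def)
  have inj: "inj_on f P"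
    using K dist_le_imp_continuous_inverse(1)[of Q _ f] P(1) by (metis inj_on_subset)
  have fP: "f ` B \<in> sets borel" if "B \<subseteq> P" "B \<in> sets borel" for B
    using img[OF that(2)] that(1) P(1) by (simp add: Int_absorb1)
  have int_meas: "(\<lambda>y. ennreal_powr (\<rho> y) p * indicator (f ` P) y) \<in> borel_measurable lebesgue"
  proof (rule measurable_completion)
    note \<rho>[measurable]
    have [measurable]: "f ` P \<in> sets borel" using fP P(2) by blast
    show "(\<lambda>y. ennreal_powr (\<rho> y) p * indicator (f ` P) y) \<in> borel_measurable lborel" by measurable
  qed
  \<comment> \<open>From \<open>c / (1 + s) \<le> onorm f'\<close> and
    \<open>\<bar>det (matrix f')\<bar> \<le> (1 + s) * d\<close>. The volume estimate carries the
    factor \<open>(1 + s) / d * c powr p\<close>, which equals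
    \<open>(1 + s) powr (p + 2) * \<kappa>\<close>.\<close>
  define \<kappa> where "\<kappa> = (c / (1 + s)) powr p / ((1 + s) * d)"
  have \<kappa>0: "\<kappa> \<ge> 0" using c d s by (auto simp: \<kappa>_def)
  have out: "ennreal \<kappa> \<le> outer_dilatation p f x" if x: "x \<in> P" for x
  proof -
    have f': "(f has_derivative frechet_derivative f (at x)) (at x)"
      using diff[OF x] frechet_derivative_works by blast
    let ?f' = "frechet_derivative f (at x)"
    have b: "c \<le> (1 + s) * onorm ?f'" "\<bar>det (matrix ?f')\<bar> \<le> (1 + s) * d" "d \<le> (1 + s) * \<bar>det (matrix ?f')\<bar>"
      using der[OF _ f'] x P by auto
    have J: "det (matrix ?f') \<noteq> 0" using b(3) d by auto
    have "\<kappa> \<le> onorm ?f' powr p / \<bar>det (matrix ?f')\<bar>"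
      unfolding \<kappa>_def using b c d s J p
      by (intro frac_le powr_mono2) (auto simp: divide_le_eq mult.commute)
    then show ?thesis using J diff[OF x] by (simp add: outer_dilatation_def Let_def ennreal_leI)
  qed
  have meas: "f \<in> measurable (restrict_space lebesgue P) borel"
  proof -
    have "f \<in> measurable (restrict_space borel P) borel"
      using D by (intro borel_measurable_continuous_on_restrict) (rule continuous_on_subset)
    then show ?thesis by (rule measurable_restrict_space_superset) auto
  qed
  have "(\<integral>\<^sup>+x\<in>P. ennreal_powr (ennreal c * \<rho> (f x)) p \<partial>lebesgue)
      \<le> ennreal ((1 + s) / d) * (\<integral>\<^sup>+y\<in>f ` P. ennreal_powr (ennreal c * \<rho> y) p \<partial>lebesgue)"
  proof (rule nn_integral_le_of_emeasure_le[where h = f and h' = "\<lambda>y. y" and \<psi> = "\<lambda>y. ennreal_powr (ennreal c * \<rho> y) p"])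
    show "P \<inter> space lebesgue \<in> sets lebesgue" using P by auto
    show "f ` P \<inter> space lebesgue \<in> sets lebesgue" using fP[of P] P by auto
    show "f \<in> measurable (restrict_space lebesgue P) borel" by (rule meas)
    show "(\<lambda>y. y) \<in> measurable (restrict_space lebesgue (f ` P)) borel"
      by (intro measurable_restrict_space1 measurable_completion) auto
    show "(\<lambda>y. ennreal_powr (ennreal c * \<rho> y) p) \<in> borel_measurable borel" using \<rho> by measurable
    fix A :: "(real^'n) set" assume A: "A \<in> sets borel"
    let ?B = "f -` A \<inter> P"
    have B: "?B \<in> sets borel"
    proof -
      have "f \<in> measurable (restrict_space borel P) borel"
        using D by (intro borel_measurable_continuous_on_restrict) (rule continuous_on_subset)
      from measurable_sets[OF this A] show ?thesis
        using P by (simp add: sets_restrict_space_iff space_restrict_space)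
    qed
    have fB: "f ` ?B = A \<inter> f ` P" by auto
    have "ennreal (d / (1 + s)) * emeasure lebesgue ?B \<le> emeasure lebesgue (f ` ?B)"
    proof (rule emeasure_differentiable_image_ge[where f' = "\<lambda>x. frechet_derivative f (at x)"])
      show "bounded ?B" using bd P by (meson bounded_subset inf.cobounded2)
      show "inj_on f ?B" using inj by (rule inj_on_subset) auto
      show "f ` ?B \<in> sets borel" using fP B by auto
      fix x assume "x \<in> ?B"
      then have x: "x \<in> P" by simp
      show f': "(f has_derivative frechet_derivative f (at x)) (at x)"
        using diff[OF x] frechet_derivative_works by blast
      show "d / (1 + s) \<le> \<bar>det (matrix (frechet_derivative f (at x)))\<bar>"
        using der[OF _ f'] x P s by (auto simp: divide_le_eq mult.commute)
    qed (rule B)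
    then have "ennreal ((1 + s) / d) * (ennreal (d / (1 + s)) * emeasure lebesgue ?B)
        \<le> ennreal ((1 + s) / d) * emeasure lebesgue (f ` ?B)" by (rule mult_left_mono) simp
    then show "emeasure lebesgue (f -` A \<inter> (P \<inter> space lebesgue))
        \<le> ennreal ((1 + s) / d) * emeasure lebesgue ((\<lambda>y. y) -` A \<inter> (f ` P \<inter> space lebesgue))"
      using d s by (simp add: fB mult.assoc[symmetric] ennreal_mult[symmetric])
  qed
  also have "\<dots> = ennreal ((1 + s) / d) * (ennreal (c powr p) * (\<integral>\<^sup>+y\<in>f ` P. ennreal_powr (\<rho> y) p \<partial>lebesgue))"
    using int_meas
    unfolding ennreal_powr_mult[OF c] by (subst nn_integral_cmult[symmetric]) (auto simp: mult.assoc)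
  also have "\<dots> = ennreal ((1 + s) powr (p + 2)) * (ennreal \<kappa> * (\<integral>\<^sup>+y\<in>f ` P. ennreal_powr (\<rho> y) p \<partial>lebesgue))"
  proof -
    have "(1 + s) / d * c powr p = (1 + s) powr (p + 2) * \<kappa>"
      using s c d by (simp add: \<kappa>_def powr_add powr_divide power2_eq_square)
    then show ?thesis
      using s c d \<kappa>0 by (simp add: mult.assoc[symmetric] ennreal_mult[symmetric])
  qed
  also have "ennreal \<kappa> * (\<integral>\<^sup>+y\<in>f ` P. ennreal_powr (\<rho> y) p \<partial>lebesgue)
      = (\<integral>\<^sup>+y\<in>f ` P. ennreal \<kappa> * ennreal_powr (\<rho> y) p \<partial>lebesgue)"
    using int_meas by (subst nn_integral_cmult[symmetric]) (auto simp: mult.assoc)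
  finally show ?thesis using out by blast
qed

text \<open>As \<open>f\<close> is \<open>c\<close>-Lipschitz on the piece, the inverse pushes
  Hausdorff measure on the image forward to at most \<open>c ^ k\<close> times Hausdorff measure on
  \<open>P\<close>. \<open>N\<close> stands for the multiplicity of a surface. The first claim
  prepares the summation over pieces.\<close>

lemma nearly_linear_area_le:
  fixes f :: "real^'n \<Rightarrow> real^'n::finite" and N \<phi> :: "real^'n \<Rightarrow> ennreal"
  assumes k: "k \<ge> 1" and nl: "nearly_linear_on s f Q c d" and P: "P \<subseteq> Q" "P \<in> sets borel"
    and D: "open D" "continuous_on D f" "P \<subseteq> D"
    and \<phi>: "\<phi> \<in> borel_measurable borel" and N: "N \<in> borel_measurable borel"
  shows "(\<lambda>y. \<phi> y * N (inv_into Q f y) * indicator (f ` P) y) \<in> borel_measurable borel"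
    and "(\<integral>\<^sup>+ y\<in>f ` P. \<phi> y * N (inv_into Q f y) \<partial>hausdorff_measure k)
      \<le> ennreal (c ^ k) * (\<integral>\<^sup>+ x\<in>P. \<phi> (f x) * N x \<partial>hausdorff_measure k)"
proof -
  let ?g = "inv_into Q f"
  have c: "c > 0" and img: "\<And>B. B \<in> sets borel \<Longrightarrow> f ` (Q \<inter> B) \<in> sets borel"
    and K: "\<exists>K. \<forall>x\<in>Q. \<forall>y\<in>Q. dist x y \<le> K * dist (f x) (f y)"
    and lip: "\<And>x y. x \<in> Q \<Longrightarrow> y \<in> Q \<Longrightarrow> dist (f x) (f y) \<le> c * dist x y"
    using nl by (auto simp: nearly_linear_on_def)
  obtain K where K: "\<And>x y. x \<in> Q \<Longrightarrow> y \<in> Q \<Longrightarrow> dist x y \<le> K * dist (f x) (f y)" using K by blast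
  have inj: "inj_on f Q" and cont: "continuous_on (f ` Q) ?g"
    using dist_le_imp_continuous_inverse[OF K] by auto
  have fP: "f ` B \<in> sets borel" if "B \<subseteq> P" "B \<in> sets borel" for B
    using img[OF that(2)] that(1) P(1) by (simp add: Int_absorb1)
  have gm: "?g \<in> measurable (restrict_space borel (f ` P)) borel"
    using cont P by (intro borel_measurable_continuous_on_restrict) (auto intro: continuous_on_subset)
  have "(\<lambda>y. N (?g y)) \<in> borel_measurable (restrict_space borel (f ` P))"
    using gm N by (rule measurable_compose)
  from borel_measurable_times_ennreal[OF measurable_restrict_space1[OF \<phi>] this]
  have "(\<lambda>y. \<phi> y * N (?g y)) \<in> borel_measurable (restrict_space borel (f ` P))" .
  then show "(\<lambda>y. \<phi> y * N (?g y) * indicator (f ` P) y) \<in> borel_measurable borel"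
    using fP[of P] P by (simp add: borel_measurable_restrict_space_iff_ennreal)
  have sub: "sets (borel :: (real^'n) measure) \<subseteq> sets (hausdorff_measure k)"
    using borel_subset_sets_hausdorff_measure[OF k] .
  have sp: "space (hausdorff_measure k :: (real^'n) measure) = UNIV"
    using space_hausdorff_measure[OF k] .
  \<comment> \<open>The indicator makes \<open>\<psi>\<close> Borel on the whole space and changes
    nothing on \<open>P\<close>.\<close>
  define \<psi> where "\<psi> x = (\<phi> (f x) * indicator P x) * N x" for x
  have \<psi>: "\<psi> \<in> borel_measurable borel"
    unfolding \<psi>_def using borel_measurable_comp_indicator[OF D(1,2) \<phi> P(2) D(3)] N by measurable
  have "(\<integral>\<^sup>+ y\<in>f ` P. \<psi> (?g y) \<partial>hausdorff_measure k)
      \<le> ennreal (c ^ k) * (\<integral>\<^sup>+ x\<in>P. \<psi> x \<partial>hausdorff_measure k)"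
  proof (rule nn_integral_le_of_emeasure_le[where h = ?g and h' = "\<lambda>x. x" and \<psi> = \<psi>])
    show "f ` P \<inter> space (hausdorff_measure k) \<in> sets (hausdorff_measure k)"
      using fP[of P] P sub by (auto simp: sp)
    show "P \<inter> space (hausdorff_measure k) \<in> sets (hausdorff_measure k)" using P sub by (auto simp: sp)
    show "?g \<in> measurable (restrict_space (hausdorff_measure k) (f ` P)) borel"
      using gm sub by (rule measurable_restrict_space_superset) (simp add: sp)
    show "(\<lambda>x. x) \<in> measurable (restrict_space (hausdorff_measure k) P) borel"
      by (intro measurable_restrict_space1 borel_measurable_hausdorff_measure k) auto
    show "\<psi> \<in> borel_measurable borel" by (rule \<psi>)
    fix A :: "(real^'n) set" assume A: "A \<in> sets borel"
    have eq: "?g -` A \<inter> (f ` P \<inter> space (hausdorff_measure k)) = f ` (A \<inter> P)"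
      using inj P by (auto simp: sp subset_eq)
    have "f ` (A \<inter> P) \<in> sets (hausdorff_measure k)" "A \<inter> P \<in> sets (hausdorff_measure k)"
      using fP[of "A \<inter> P"] A P sub by auto
    moreover have "hausdorff_outer k (f ` (A \<inter> P)) \<le> ennreal (c ^ k) * hausdorff_outer k (A \<inter> P)"
      using lip P c by (intro hausdorff_outer_lipschitz_image) auto
    ultimately show "emeasure (hausdorff_measure k) (?g -` A \<inter> (f ` P \<inter> space (hausdorff_measure k)))
        \<le> ennreal (c ^ k) * emeasure (hausdorff_measure k) ((\<lambda>x. x) -` A \<inter> (P \<inter> space (hausdorff_measure k)))"
      unfolding eq by (simp add: emeasure_hausdorff_measure[OF k] sp)
  qed
  also have "(\<integral>\<^sup>+ y\<in>f ` P. \<psi> (?g y) \<partial>hausdorff_measure k)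
      = (\<integral>\<^sup>+ y\<in>f ` P. \<phi> y * N (?g y) \<partial>hausdorff_measure k)"
    using inj P by (intro nn_integral_cong) (auto simp: \<psi>_def indicator_def subset_eq)
  also have "(\<integral>\<^sup>+ x\<in>P. \<psi> x \<partial>hausdorff_measure k) = (\<integral>\<^sup>+ x\<in>P. \<phi> (f x) * N x \<partial>hausdorff_measure k)"
    by (intro nn_integral_cong) (auto simp: \<psi>_def indicator_def)
  finally show "(\<integral>\<^sup>+ y\<in>f ` P. \<phi> y * N (?g y) \<partial>hausdorff_measure k)
      \<le> ennreal (c ^ k) * (\<integral>\<^sup>+ x\<in>P. \<phi> (f x) * N x \<partial>hausdorff_measure k)" .
qed

subsection \<open>The modulus inequality\<close>

lemma disjoint_nearly_linear_cover:
  fixes f :: "real^'n \<Rightarrow> real^'n::finite"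
  assumes D: "open D" and f: "continuous_on D f" and s: "s > 0" and G: "G \<in> sets borel" "G \<subseteq> D"
    and diff: "\<And>x. x \<in> G \<Longrightarrow> f differentiable (at x)" and lower: "\<And>x. x \<in> G \<Longrightarrow> 0 < lower_distortion D f x"
  obtains Q P :: "nat \<Rightarrow> (real^'n) set" and c d :: "nat \<Rightarrow> real"
  where "\<And>i. nearly_linear_on s f (Q i) (c i) (d i)" "\<And>i. P i \<subseteq> Q i" "\<And>i. P i \<in> sets borel"
    "disjoint_family P" "(\<Union>i. P i) = G"
proof -
  obtain \<Q> where \<Q>: "countable \<Q>" "\<And>Q. Q \<in> \<Q> \<Longrightarrow> \<exists>c d. nearly_linear_on s f Q c d"
      "\<And>x. x \<in> D \<Longrightarrow> f differentiable (at x) \<Longrightarrow> 0 < lower_distortion D f x \<Longrightarrow> x \<in> \<Union>\<Q>"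
    using nearly_linear_cover[OF D f s] by metis
  \<comment> \<open>The empty set is added so that there is a family to enumerate in every case; it
    is nearly linear with constants 1.\<close>
  define Q where "Q = from_nat_into (insert {} \<Q>)"
  have ran: "range Q = insert {} \<Q>"
    unfolding Q_def using \<Q>(1) by (intro range_from_nat_into) auto
  have "nearly_linear_on s f {} 1 1" by (simp add: nearly_linear_on_def)
  then have "\<exists>c d. nearly_linear_on s f (Q i) c d" for i
    using \<Q>(2) ran by (metis insertE rangeI)
  then obtain c d where nl: "\<And>i. nearly_linear_on s f (Q i) (c i) (d i)" by metis
  have "range (disjointed Q) \<subseteq> sets borel"
    using nl by (intro sets.range_disjointed_sets) (auto simp: nearly_linear_on_def)
  then have dj: "disjointed Q i \<in> sets borel" for i by blast
  show ?thesis
  proof (rule that[of Q c d "\<lambda>i. G \<inter> disjointed Q i"])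
    show "disjoint_family (\<lambda>i. G \<inter> disjointed Q i)"
      using disjoint_family_disjointed[of Q] by (auto simp: disjoint_family_on_def)
    have "G \<subseteq> \<Union>(range Q)" using \<Q>(3) diff lower G(2) unfolding ran by auto
    then show "(\<Union>i. G \<inter> disjointed Q i) = G" using UN_disjointed_eq[of Q] by auto
    show "G \<inter> disjointed Q i \<subseteq> Q i" for i using disjointed_subset[of Q i] by blast
  qed (use nl dj G in auto)
qed

text \<open>Each piece whose image contains \<open>y\<close> supplies a preimage of
  \<open>y\<close>, and disjoint pieces supply different ones. The corresponding constants
  \<open>\<kappa> i\<close> therefore add up to at most the dilatation sum over the fibre.\<close>

lemma sum_nearly_linear_volume_le:
  fixes f :: "real^'n \<Rightarrow> real^'n::finite"
  assumes D: "open D" "continuous_on D f" and s: "s > 0" and p: "p > 0"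
    and nl: "\<And>i::nat. nearly_linear_on s f (Q i) (c i) (d i)"
    and P: "\<And>i. P i \<subseteq> Q i" "\<And>i. P i \<in> sets borel" "disjoint_family P" "\<And>i. P i \<subseteq> E" and E: "E \<subseteq> D"
    and diff: "\<And>i x. x \<in> P i \<Longrightarrow> f differentiable (at x)" and \<rho>: "\<rho> \<in> borel_measurable borel"
  shows "(\<integral>\<^sup>+ x. ennreal_powr (\<Sum>i. ennreal (c i) * \<rho> (f x) * indicator (P i) x) p \<partial>lebesgue)
    \<le> ennreal ((1 + s) powr (p + 2)) *
      (\<integral>\<^sup>+ y\<in>f ` E. (inner_dilatation_inverse p f E y * ennreal_powr (\<rho> y) p) \<partial>lebesgue)"
proof -
  have PD: "P i \<subseteq> D" for i using P(4) E by blast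
  have "\<exists>\<kappa>. (\<forall>x\<in>P i. \<kappa> \<le> outer_dilatation p f x) \<and>
      (\<integral>\<^sup>+ x\<in>P i. ennreal_powr (ennreal (c i) * \<rho> (f x)) p \<partial>lebesgue)
      \<le> ennreal ((1 + s) powr (p + 2)) * (\<integral>\<^sup>+ y\<in>f ` P i. \<kappa> * ennreal_powr (\<rho> y) p \<partial>lebesgue)" for i
    by (rule nearly_linear_volume_le[OF nl s P(1,2) D PD diff \<rho> p])
  from choice[OF allI[OF this]] obtain \<kappa> where \<kappa>v: "\<forall>i. (\<forall>x\<in>P i. \<kappa> i \<le> outer_dilatation p f x) \<and>
      (\<integral>\<^sup>+ x\<in>P i. ennreal_powr (ennreal (c i) * \<rho> (f x)) p \<partial>lebesgue)
      \<le> ennreal ((1 + s) powr (p + 2)) * (\<integral>\<^sup>+ y\<in>f ` P i. \<kappa> i * ennreal_powr (\<rho> y) p \<partial>lebesgue)" ..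
  have \<kappa>: "\<kappa> i \<le> outer_dilatation p f x" if "x \<in> P i" for i x using \<kappa>v that by simp
  have vol: "(\<integral>\<^sup>+ x\<in>P i. ennreal_powr (ennreal (c i) * \<rho> (f x)) p \<partial>lebesgue)
      \<le> ennreal ((1 + s) powr (p + 2)) * (\<integral>\<^sup>+ y\<in>f ` P i. \<kappa> i * ennreal_powr (\<rho> y) p \<partial>lebesgue)" for i
    using \<kappa>v by simp
  have fP: "f ` P i \<in> sets borel" for i
    using nl[of i] P(1,2)[of i] unfolding nearly_linear_on_def by (metis Int_absorb1)
  \<comment> \<open>By disjointness at most one summand is nonzero, so the power passes through the
    sum; off all pieces both sides are 0.\<close>
  have powr_sum: "ennreal_powr (\<Sum>i. ennreal (c i) * \<rho> (f x) * indicator (P i) x) p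
      = (\<Sum>i. ennreal_powr (ennreal (c i) * \<rho> (f x)) p * indicator (P i) x)" for x
  proof (cases "\<exists>i. x \<in> P i")
    case True
    then obtain i where "x \<in> P i" ..
    then show ?thesis using P(3) by (simp add: suminf_cmult_indicator)
  qed simp
  have meas: "(\<lambda>x. ennreal_powr (ennreal (c i) * \<rho> (f x)) p * indicator (P i) x) \<in> borel_measurable lebesgue" for i
  proof (rule measurable_completion)
    have "(\<lambda>y. ennreal_powr (ennreal (c i) * \<rho> y) p) \<in> borel_measurable borel" using \<rho> by measurable
    from borel_measurable_comp_indicator[OF D this P(2) PD]
    show "(\<lambda>x. ennreal_powr (ennreal (c i) * \<rho> (f x)) p * indicator (P i) x) \<in> borel_measurable lborel" by simp
  qed
  have meas': "(\<lambda>y. \<kappa> i * ennreal_powr (\<rho> y) p * indicator (f ` P i) y) \<in> borel_measurable lebesgue" for i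
  proof (rule measurable_completion)
    note \<rho>[measurable]
    have [measurable]: "f ` P i \<in> sets borel" by (rule fP)
    show "(\<lambda>y. \<kappa> i * ennreal_powr (\<rho> y) p * indicator (f ` P i) y) \<in> borel_measurable lborel" by measurable
  qed
  have "(\<integral>\<^sup>+ x. ennreal_powr (\<Sum>i. ennreal (c i) * \<rho> (f x) * indicator (P i) x) p \<partial>lebesgue)
      = (\<Sum>i. \<integral>\<^sup>+ x\<in>P i. ennreal_powr (ennreal (c i) * \<rho> (f x)) p \<partial>lebesgue)"
    unfolding powr_sum by (rule nn_integral_suminf) (rule meas)
  also have "\<dots> \<le> (\<Sum>i. ennreal ((1 + s) powr (p + 2)) * (\<integral>\<^sup>+ y\<in>f ` P i. \<kappa> i * ennreal_powr (\<rho> y) p \<partial>lebesgue))"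
    by (intro suminf_le vol) auto
  also have "\<dots> = ennreal ((1 + s) powr (p + 2)) * (\<Sum>i. \<integral>\<^sup>+ y\<in>f ` P i. \<kappa> i * ennreal_powr (\<rho> y) p \<partial>lebesgue)"
    by (rule ennreal_suminf_cmult)
  also have "(\<Sum>i. \<integral>\<^sup>+ y\<in>f ` P i. \<kappa> i * ennreal_powr (\<rho> y) p \<partial>lebesgue)
      = (\<integral>\<^sup>+ y. (\<Sum>i. \<kappa> i * ennreal_powr (\<rho> y) p * indicator (f ` P i) y) \<partial>lebesgue)"
    by (rule nn_integral_suminf[symmetric]) (rule meas')
  also have "\<dots> \<le> (\<integral>\<^sup>+ y\<in>f ` E. (inner_dilatation_inverse p f E y * ennreal_powr (\<rho> y) p) \<partial>lebesgue)"
  proof (rule nn_integral_mono)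
    fix y
    have part: "(\<Sum>i<n. \<kappa> i * indicator (f ` P i) y) \<le> inner_dilatation_inverse p f E y" for n
    proof -
      let ?I = "{i. i < n \<and> y \<in> f ` P i}"
      have "\<forall>i\<in>?I. \<exists>x. x \<in> P i \<and> f x = y" by auto
      then obtain x where x: "\<And>i. i \<in> ?I \<Longrightarrow> x i \<in> P i \<and> f (x i) = y" by metis
      have inj: "inj_on x ?I"
      proof (rule inj_onI)
        fix i j assume "i \<in> ?I" "j \<in> ?I" "x i = x j"
        then have "x i \<in> P i \<inter> P j" using x by (metis IntI)
        then show "i = j" using P(3) by (auto simp: disjoint_family_on_def)
      qed
      have "(\<Sum>i<n. \<kappa> i * indicator (f ` P i) y) = (\<Sum>i\<in>?I. \<kappa> i)"
        by (rule sum.mono_neutral_cong_right) auto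
      also have "\<dots> \<le> (\<Sum>i\<in>?I. outer_dilatation p f (x i))"
        using x \<kappa> by (intro sum_mono) blast
      also have "\<dots> = (\<Sum>z\<in>x ` ?I. outer_dilatation p f z)"
        using inj by (simp add: sum.reindex)
      also have "\<dots> \<le> inner_dilatation_inverse p f E y"
        using x P(4) by (intro sum_outer_dilatation_le_inner) auto
      finally show ?thesis .
    qed
    show "(\<Sum>i. \<kappa> i * ennreal_powr (\<rho> y) p * indicator (f ` P i) y)
        \<le> inner_dilatation_inverse p f E y * ennreal_powr (\<rho> y) p * indicator (f ` E) y"
    proof (cases "y \<in> f ` E")
      case True
      have "(\<Sum>i. \<kappa> i * ennreal_powr (\<rho> y) p * indicator (f ` P i) y)
          = (\<Sum>i. \<kappa> i * indicator (f ` P i) y) * ennreal_powr (\<rho> y) p"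
        by (subst ennreal_suminf_multc[symmetric]) (simp add: mult_ac)
      also have "\<dots> \<le> inner_dilatation_inverse p f E y * ennreal_powr (\<rho> y) p"
        by (intro mult_right_mono suminf_le_const part) auto
      finally show ?thesis using True by simp
    next
      case False
      then have "y \<notin> f ` P i" for i using P(4) by blast
      then show ?thesis by simp
    qed
  qed
  finally show ?thesis by (simp add: mult_left_mono)
qed

text \<open>The multiplicity of the composed surface is distributed over the inverse branches of
  \<open>f\<close> on the pieces, and each branch is handled by
  \<open>nearly_linear_area_le\<close>. The points of \<open>B\<close> may escape the pieces because
  their image is null.\<close>

lemma sum_nearly_linear_area_ge:
  fixes f :: "real^'n \<Rightarrow> real^'n::finite" and S :: "('k::finite, 'n) surface"
  assumes D: "open D" "continuous_on D f"
    and nl: "\<And>i::nat. nearly_linear_on s f (Q i) (c i) (d i)"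
    and P: "\<And>i. P i \<subseteq> Q i" "\<And>i. P i \<in> sets borel" "disjoint_family P" "\<And>i. P i \<subseteq> D"
    and \<rho>: "\<rho> \<in> borel_measurable borel" and S: "S \<in> surfaces_in A"
    and B: "f ` B \<in> null_sets (hausdorff_measure CARD('k))"
    and cover: "\<And>x. x \<in> surface_image S \<Longrightarrow> x \<notin> B \<Longrightarrow> \<rho> (f x) \<noteq> 0 \<Longrightarrow> \<exists>i. x \<in> P i"
  shows "surface_integral (surface_comp f S) (\<lambda>y. \<rho> y ^ CARD('k))
    \<le> surface_integral S (\<lambda>x. (\<Sum>i. ennreal (c i) * \<rho> (f x) * indicator (P i) x) ^ CARD('k))"
proof -
  let ?k = "CARD('k)" and ?N = "multiplicity_fun S"
  let ?H = "hausdorff_measure ?k :: (real^'n) measure"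
  have k: "?k \<ge> 1" by (simp add: Suc_leI)
  have N: "?N \<in> borel_measurable borel" by (rule borel_measurable_multiplicity_fun[OF S])
  have \<phi>: "(\<lambda>y. \<rho> y ^ ?k) \<in> borel_measurable borel" using \<rho> by measurable
  note area = nearly_linear_area_le[OF k nl P(1,2) D P(4) \<phi> N]
  \<comment> \<open>Off the image of \<open>B\<close>, and where \<rho> is nonzero, every parameter
    over \<open>y\<close> is mapped by \<open>S\<close> into some piece and is counted by that
    inverse branch. Where \<rho> vanishes, so does the left side, as the exponent is
    positive.\<close>
  have fib: "\<rho> y ^ ?k * multiplicity_fun (surface_comp f S) y
      \<le> (\<Sum>i. \<rho> y ^ ?k * ?N (inv_into (Q i) f y) * indicator (f ` P i) y)" if y: "y \<notin> f ` B" for y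
  proof (cases "\<rho> y = 0")
    case False
    let ?F = "\<lambda>i. if y \<in> f ` P i then {u \<in> fst S. snd S u = inv_into (Q i) f y} else {}"
    have sub: "{u \<in> fst S. f (snd S u) = y} \<subseteq> (\<Union>i. ?F i)"
    proof
      fix u assume u: "u \<in> {u \<in> fst S. f (snd S u) = y}"
      let ?x = "snd S u"
      have "?x \<in> surface_image S" using u by (auto simp: surface_image_def)
      then obtain i where i: "?x \<in> P i" using cover[of ?x] u y False by auto
      have "\<exists>K. \<forall>x\<in>Q i. \<forall>y\<in>Q i. dist x y \<le> K * dist (f x) (f y)"
        using nl[of i] by (simp add: nearly_linear_on_def)
      then have "inj_on f (Q i)" using dist_le_imp_continuous_inverse(1)[of "Q i" _ f] by blast
      then have "inv_into (Q i) f (f ?x) = ?x" using i P(1) by (intro inv_into_f_f) auto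
      then have "inv_into (Q i) f y = ?x" using u by simp
      then have "u \<in> ?F i" using u i by auto
      then show "u \<in> (\<Union>i. ?F i)" by blast
    qed
    have "multiplicity_fun (surface_comp f S) y = emeasure (count_space UNIV) {u \<in> fst S. f (snd S u) = y}"
      by (simp add: multiplicity_fun_def surface_comp_def)
    also have "\<dots> \<le> emeasure (count_space UNIV) (\<Union>i. ?F i)" using sub by (intro emeasure_mono) auto
    also have "\<dots> \<le> (\<Sum>i. emeasure (count_space UNIV) (?F i))"
      by (intro emeasure_subadditive_countably) auto
    also have "\<dots> = (\<Sum>i. ?N (inv_into (Q i) f y) * indicator (f ` P i) y)"
      by (intro suminf_cong) (simp add: multiplicity_fun_def)
    finally have "\<rho> y ^ ?k * multiplicity_fun (surface_comp f S) y
        \<le> \<rho> y ^ ?k * (\<Sum>i. ?N (inv_into (Q i) f y) * indicator (f ` P i) y)"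
      by (rule mult_left_mono) simp
    then show ?thesis by (simp add: ennreal_suminf_cmult[symmetric] mult.assoc del: ennreal_suminf_cmult)
  qed (simp add: power_0_left)
  have "surface_integral (surface_comp f S) (\<lambda>y. \<rho> y ^ ?k)
      = (\<integral>\<^sup>+ y. \<rho> y ^ ?k * multiplicity_fun (surface_comp f S) y \<partial>?H)"
    by (simp add: surface_integral_def)
  also have "\<dots> \<le> (\<integral>\<^sup>+ y. (\<Sum>i. \<rho> y ^ ?k * ?N (inv_into (Q i) f y) * indicator (f ` P i) y) \<partial>?H)"
    using AE_not_in[OF B] fib by (intro nn_integral_mono_AE) auto
  also have "\<dots> = (\<Sum>i. \<integral>\<^sup>+ y\<in>f ` P i. \<rho> y ^ ?k * ?N (inv_into (Q i) f y) \<partial>?H)"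
    by (intro nn_integral_suminf borel_measurable_hausdorff_measure[OF k] area(1))
  also have "\<dots> \<le> (\<Sum>i. ennreal (c i ^ ?k) * (\<integral>\<^sup>+ x\<in>P i. \<rho> (f x) ^ ?k * ?N x \<partial>?H))"
    by (intro suminf_le area(2)) auto
  also have "\<dots> = (\<Sum>i. \<integral>\<^sup>+ x. (ennreal (c i) * \<rho> (f x)) ^ ?k * ?N x * indicator (P i) x \<partial>?H)"
  proof (intro suminf_cong)
    fix i
    have c: "c i > 0" using nl[of i] by (simp add: nearly_linear_on_def)
    have "(\<lambda>x. \<rho> (f x) ^ ?k * indicator (P i) x * ?N x) \<in> borel_measurable borel"
      using borel_measurable_comp_indicator[OF D \<phi> P(2,4)] N by measurable
    then have "(\<lambda>x. \<rho> (f x) ^ ?k * ?N x * indicator (P i) x) \<in> borel_measurable ?H"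
      by (intro borel_measurable_hausdorff_measure[OF k]) (simp add: mult_ac)
    then show "ennreal (c i ^ ?k) * (\<integral>\<^sup>+ x\<in>P i. \<rho> (f x) ^ ?k * ?N x \<partial>?H)
        = (\<integral>\<^sup>+ x. (ennreal (c i) * \<rho> (f x)) ^ ?k * ?N x * indicator (P i) x \<partial>?H)"
      using c by (subst nn_integral_cmult[symmetric]) (simp_all add: power_mult_distrib ennreal_power mult_ac)
  qed
  also have "\<dots> = (\<integral>\<^sup>+ x. (\<Sum>i. (ennreal (c i) * \<rho> (f x)) ^ ?k * ?N x * indicator (P i) x) \<partial>?H)"
  proof (rule nn_integral_suminf[symmetric])
    fix i
    have "(\<lambda>y. (ennreal (c i) * \<rho> y) ^ ?k) \<in> borel_measurable borel" using \<rho> by measurable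
    from borel_measurable_comp_indicator[OF D this P(2,4)]
    have "(\<lambda>x. (ennreal (c i) * \<rho> (f x)) ^ ?k * indicator (P i) x * ?N x) \<in> borel_measurable borel"
      using N by measurable
    then show "(\<lambda>x. (ennreal (c i) * \<rho> (f x)) ^ ?k * ?N x * indicator (P i) x) \<in> borel_measurable ?H"
      by (intro borel_measurable_hausdorff_measure[OF k]) (simp add: mult_ac)
  qed
  also have "\<dots> = surface_integral S (\<lambda>x. (\<Sum>i. ennreal (c i) * \<rho> (f x) * indicator (P i) x) ^ ?k)"
    unfolding surface_integral_def
  proof (intro nn_integral_cong)
    fix x
    show "(\<Sum>i. (ennreal (c i) * \<rho> (f x)) ^ ?k * ?N x * indicator (P i) x)
        = (\<Sum>i. ennreal (c i) * \<rho> (f x) * indicator (P i) x) ^ ?k * ?N x"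
    proof (cases "\<exists>i. x \<in> P i")
      case True
      then obtain i where "x \<in> P i" ..
      then show ?thesis using P(3) by (simp add: suminf_cmult_indicator)
    next
      case False
      then show ?thesis by (simp add: power_0_left)
    qed
  qed
  finally show ?thesis .
qed

section \<open>Images of surfaces and the test function\<close>

lemma surfaces_in_mono: "A \<subseteq> B \<Longrightarrow> surfaces_in A \<subseteq> surfaces_in B"
  by (auto simp: surfaces_in_def continuous_map_in_subtopology)

lemma surface_image_subset:
  assumes "S \<in> surfaces_in A" shows "surface_image S \<subseteq> A"
proof -
  obtain \<omega> g where S: "S = (\<omega>, g)" by (cases S)
  then have "\<omega> \<subseteq> topspace (Alexandroff_compactification euclidean)"
    "continuous_map (subtopology (Alexandroff_compactification euclidean) \<omega>) (top_of_set A) g"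
    using assms
    by (auto simp: surfaces_in_def simp del: topspace_Alexandroff_compactification dest: openin_subset)
  then show ?thesis
    by (auto simp: S surface_image_def continuous_map_in_subtopology Int_absorb1
        simp del: topspace_Alexandroff_compactification)
qed

lemma multiplicity_fun_eq_0_iff: "multiplicity_fun S y = 0 \<longleftrightarrow> y \<notin> surface_image S"
  by (auto simp: multiplicity_fun_def surface_image_def emeasure_count_space_eq_0)

lemma multiplicity_fun_ge_1: "y \<in> surface_image S \<Longrightarrow> 1 \<le> multiplicity_fun S y"
proof -
  assume "y \<in> surface_image S"
  then obtain u where "u \<in> fst S" "snd S u = y" by (auto simp: surface_image_def)
  then have "emeasure (count_space UNIV) {u} \<le> multiplicity_fun S y"
    unfolding multiplicity_fun_def by (intro emeasure_mono) auto
  then show ?thesis by simp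
qed

text \<open>The summand \<open>ennreal s\<close> pays for the exceptional family of the A-property:
  modulus 0 provides admissible densities of arbitrarily small integral, not necessarily one of
  integral 0.\<close>

lemma modulus_le_of_finite:
  fixes f :: "real^'n \<Rightarrow> real^'n" and \<Gamma> :: "('k::finite, 'n::finite) surface set"
  assumes p: "p > 0" and D: "open D" "continuous_on D f"
    and fmd: "finite_metric_distortion D f"
    and A: "A_property TYPE('k) p D f"
    and E: "E \<in> sets borel" "E \<subseteq> D"
    and \<Gamma>: "\<Gamma> \<subseteq> surfaces_in E"
    and adm: "\<rho>s \<in> admissible (surface_comp f ` \<Gamma>)"
    and fin: "(\<integral>\<^sup>+ y\<in>f ` E. (inner_dilatation_inverse p f E y * ennreal_powr (\<rho>s y) p) \<partial>lebesgue) < \<infinity>"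
    and s: "s > 0"
  shows "modulus p \<Gamma> \<le> ennreal ((1 + s) powr (p + 2)) *
    (\<integral>\<^sup>+ y\<in>f ` E. (inner_dilatation_inverse p f E y * ennreal_powr (\<rho>s y) p) \<partial>lebesgue) + ennreal s"
    (is "_ \<le> _ * ?R + _")
proof -
  let ?k = "CARD('k)"
  let ?H = "hausdorff_measure ?k :: (real^'n) measure"
  have k: "?k \<ge> 1" by (simp add: Suc_leI)
  have \<rho>s: "\<rho>s \<in> borel_measurable borel"
    and \<rho>s1: "\<And>S. S \<in> \<Gamma> \<Longrightarrow> 1 \<le> surface_integral (surface_comp f S) (\<lambda>y. \<rho>s y ^ ?k)"
    using adm by (auto simp: admissible_def)
  have "AE x in lebesgue. x \<in> D \<longrightarrow> 0 < lower_distortion D f x"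
    using fmd by (auto simp: finite_metric_distortion_def elim: eventually_mono)
  then obtain N1 where N1: "N1 \<in> null_sets lebesgue" "{x. \<not> (x \<in> D \<longrightarrow> 0 < lower_distortion D f x)} \<subseteq> N1"
    by (auto simp: eventually_ae_filter)
  have "N1 \<union> {x \<in> E. \<not> f differentiable (at x) \<and> 0 < lower_distortion D f x \<and> \<rho>s (f x) \<noteq> 0} \<in> null_sets lebesgue"
    using N1(1) null_nondifferentiability_set[OF D E \<rho>s fin] by (auto simp: negligible_iff_null_sets)
  \<comment> \<open>The Lebesgue null set is enlarged to a Borel one, so that its trace on a surface
    is measurable for Hausdorff measure and the value \<infinity> on it gives a Borel
    density.\<close>
  then obtain N0 where N0: "N0 \<in> null_sets lborel"
      "N1 \<union> {x \<in> E. \<not> f differentiable (at x) \<and> 0 < lower_distortion D f x \<and> \<rho>s (f x) \<noteq> 0} \<subseteq> N0"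
    unfolding null_sets_completion_iff2 by blast
  have N0b: "N0 \<in> sets borel" using N0(1) by (auto simp: null_sets_def)
  \<comment> \<open>Removing \<open>N0\<close> ensures positive lower distortion while
    \<open>G\<close> stays Borel. Points with \<open>\<rho>s (f x) = 0\<close> may be dropped, since
    they contribute nothing to the integral of \<open>\<rho>s\<close> over the composed
    surface.\<close>
  define G where "G = {x \<in> D. f differentiable (at x)} \<inter> {x. \<rho>s (f x) * indicator E x \<noteq> 0} - N0"
  have "{x. \<rho>s (f x) * indicator E x \<noteq> 0} \<in> sets borel"
    using borel_measurable_comp_indicator[OF D \<rho>s E] by measurable
  then have Gb: "G \<in> sets borel" unfolding G_def using borel_differentiable_set[OF D] N0b by auto
  have GE: "G \<subseteq> E" by (auto simp: G_def indicator_def split: if_splits)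
  have GD: "G \<subseteq> D" by (auto simp: G_def)
  have G_lower: "0 < lower_distortion D f x" if "x \<in> G" for x
    using that N0(2) N1(2) by (auto simp: G_def)
  have G_diff: "f differentiable (at x)" if "x \<in> G" for x using that by (simp add: G_def)
  have GI: "x \<in> G" if "x \<in> E" "x \<notin> N0" "\<rho>s (f x) \<noteq> 0" for x
    using that N0(2) N1(2) E(2) by (auto simp: G_def)
  obtain Q P :: "nat \<Rightarrow> (real^'n) set" and c d :: "nat \<Rightarrow> real"
    where nl: "\<And>i. nearly_linear_on s f (Q i) (c i) (d i)" and P: "\<And>i. P i \<subseteq> Q i" "\<And>i. P i \<in> sets borel"
      "disjoint_family P" and UP: "(\<Union>i. P i) = G"
    by (rule disjoint_nearly_linear_cover[OF D s Gb GD G_diff G_lower]; (assumption | (rule that; assumption)))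
  have PE: "P i \<subseteq> E" and PD: "P i \<subseteq> D" and Pdiff: "\<And>x. x \<in> P i \<Longrightarrow> f differentiable (at x)" for i
    using UP GE GD G_diff by blast+
  define \<rho>1 where "\<rho>1 x = (\<Sum>i. ennreal (c i) * \<rho>s (f x) * indicator (P i) x)" for x
  have \<rho>1: "\<rho>1 \<in> borel_measurable borel"
    unfolding \<rho>1_def
  proof (rule borel_measurable_suminf_order)
    fix i
    have "(\<lambda>y. ennreal (c i) * \<rho>s y) \<in> borel_measurable borel" using \<rho>s by measurable
    then show "(\<lambda>x. ennreal (c i) * \<rho>s (f x) * indicator (P i) x) \<in> borel_measurable borel"
      by (rule borel_measurable_comp_indicator[OF D _ P(2) PD])
  qed
  define X :: "('k, 'n) surface set" where "X = {S \<in> surfaces_in D. \<not> (\<forall>B\<subseteq>surface_image S.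
      B \<in> sets ?H \<and> surface_area S B = 0 \<longrightarrow>
      f ` B \<in> sets ?H \<and> surface_area (surface_comp f S) (f ` B) = 0)}"
  have "modulus p X = 0"
    using A unfolding A_property_def almost_every_surface_def X_def .
  then have "modulus p X < ennreal s" using s by simp
  then obtain \<rho>A where \<rho>A: "\<rho>A \<in> admissible X"
      "(\<integral>\<^sup>+ x. ennreal_powr (\<rho>A x) p \<partial>lebesgue) < ennreal s"
    unfolding modulus_def INF_less_iff by blast
  have \<rho>Am: "\<rho>A \<in> borel_measurable borel"
    and \<rho>A1: "\<And>S. S \<in> X \<Longrightarrow> 1 \<le> surface_integral S (\<lambda>y. \<rho>A y ^ ?k)"
    using \<rho>A(1) by (auto simp: admissible_def)
  define \<rho>0 :: "real^'n \<Rightarrow> ennreal" where "\<rho>0 x = \<infinity> * indicator N0 x" for x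
  have \<rho>0: "\<rho>0 \<in> borel_measurable borel" unfolding \<rho>0_def using N0b by measurable
  define \<rho> where "\<rho> x = max (\<rho>1 x) (max (\<rho>0 x) (\<rho>A x))" for x
  have \<rho>_ge: "\<rho>1 x \<le> \<rho> x" "\<rho>0 x \<le> \<rho> x" "\<rho>A x \<le> \<rho> x" for x
    by (simp_all add: \<rho>_def le_max_iff_disj)
  have \<rho>m: "\<rho> \<in> borel_measurable borel" unfolding \<rho>_def using \<rho>1 \<rho>0 \<rho>Am by measurable
  have mono: "surface_integral S (\<lambda>x. g x ^ ?k) \<le> surface_integral S (\<lambda>x. \<rho> x ^ ?k)"
    if "\<And>x. g x \<le> \<rho> x" for g and S :: "('k, 'n) surface"
    unfolding surface_integral_def using that by (intro nn_integral_mono mult_right_mono power_mono) auto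
  have "1 \<le> surface_integral S (\<lambda>x. \<rho> x ^ ?k)" if S: "S \<in> \<Gamma>" for S
  proof -
    have SE: "S \<in> surfaces_in E" using S \<Gamma> by blast
    then have SD: "S \<in> surfaces_in D" using surfaces_in_mono[OF E(2)] by blast
    have N: "multiplicity_fun S \<in> borel_measurable borel" by (rule borel_measurable_multiplicity_fun[OF SE])
    have NN: "(\<lambda>x. multiplicity_fun S x * indicator N0 x) \<in> borel_measurable ?H"
      using N N0b by (intro borel_measurable_hausdorff_measure[OF k] borel_measurable_times_ennreal
          borel_measurable_indicator) auto
    consider "S \<in> X" | "(\<integral>\<^sup>+ x\<in>N0. multiplicity_fun S x \<partial>?H) \<noteq> 0"
      | "S \<notin> X" "(\<integral>\<^sup>+ x\<in>N0. multiplicity_fun S x \<partial>?H) = 0" by blast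
    then show ?thesis
    proof cases
      case 1
      show ?thesis by (rule order_trans[OF \<rho>A1[OF 1] mono]) (rule \<rho>_ge)
    next
      case 2
      have "surface_integral S (\<lambda>x. \<rho>0 x ^ ?k) = (\<integral>\<^sup>+ x. \<infinity> * (multiplicity_fun S x * indicator N0 x) \<partial>?H)"
        unfolding surface_integral_def
        by (intro nn_integral_cong) (auto simp: \<rho>0_def indicator_def power_0_left top_power_ennreal)
      also have "\<dots> = \<infinity>" using 2 NN by (subst nn_integral_cmult) (auto simp: ennreal_top_mult)
      finally have "surface_integral S (\<lambda>x. \<rho>0 x ^ ?k) = \<infinity>" .
      then have "surface_integral S (\<lambda>x. \<rho> x ^ ?k) = \<infinity>"
        using mono[of \<rho>0 S, OF \<rho>_ge(2)] by (simp add: top_unique)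
      then show ?thesis by simp
    next
      case 3
      \<comment> \<open>The A-property speaks of subsets of the image of the surface; off the image
        the multiplicity is 0, so the area does not change.\<close>
      let ?B = "N0 \<inter> surface_image S"
      have "surface_image S = {y. multiplicity_fun S y \<noteq> 0}" by (auto simp: multiplicity_fun_eq_0_iff)
      also have "\<dots> \<in> sets borel" using N by measurable
      finally have B: "?B \<in> sets ?H" using N0b borel_subset_sets_hausdorff_measure[OF k] by auto
      have "surface_area S ?B = (\<integral>\<^sup>+ x\<in>N0. multiplicity_fun S x \<partial>?H)"
        unfolding surface_area_def
        by (intro nn_integral_cong) (auto simp: indicator_def multiplicity_fun_eq_0_iff)
      then have "surface_area S ?B = 0" using 3 by simp
      then have fB: "f ` ?B \<in> sets ?H" and area: "surface_area (surface_comp f S) (f ` ?B) = 0"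
        using 3(1) SD B unfolding X_def by auto
      have "emeasure ?H (f ` ?B) = (\<integral>\<^sup>+ y. indicator (f ` ?B) y \<partial>?H)" using fB by simp
      \<comment> \<open>The multiplicity is at least 1 on the image of the composed surface, so
        vanishing area implies vanishing Hausdorff measure.\<close>
      also have "\<dots> \<le> surface_area (surface_comp f S) (f ` ?B)"
        unfolding surface_area_def
      proof (rule nn_integral_mono)
        fix y
        have "f ` ?B \<subseteq> surface_image (surface_comp f S)" by (auto simp: surface_image_def surface_comp_def)
        then show "indicator (f ` ?B) y \<le> multiplicity_fun (surface_comp f S) y * indicator (f ` ?B) y"
          using multiplicity_fun_ge_1[of y "surface_comp f S"] by (auto simp: indicator_def)
      qed
      finally have null: "f ` ?B \<in> null_sets ?H" using area fB by (simp add: null_sets_def)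
      have "surface_integral (surface_comp f S) (\<lambda>y. \<rho>s y ^ ?k) \<le> surface_integral S (\<lambda>x. \<rho>1 x ^ ?k)"
        unfolding \<rho>1_def
      proof (rule sum_nearly_linear_area_ge[OF D nl P PD \<rho>s SE null])
        fix x assume "x \<in> surface_image S" "x \<notin> ?B" "\<rho>s (f x) \<noteq> 0"
        then have "x \<in> G" using surface_image_subset[OF SE] by (intro GI) auto
        then show "\<exists>i. x \<in> P i" using UP by blast
      qed
      also have "\<dots> \<le> surface_integral S (\<lambda>x. \<rho> x ^ ?k)" by (rule mono) (rule \<rho>_ge)
      finally show ?thesis using \<rho>s1[OF S] by (rule order_trans[rotated])
    qed
  qed
  then have "\<rho> \<in> admissible \<Gamma>" using \<rho>m by (simp add: admissible_def)
  then have "modulus p \<Gamma> \<le> (\<integral>\<^sup>+ x. ennreal_powr (\<rho> x) p \<partial>lebesgue)"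
    unfolding modulus_def by (rule INF_lower)
  also have "\<dots> \<le> (\<integral>\<^sup>+ x. ennreal_powr (\<rho>1 x) p + (ennreal_powr (\<rho>0 x) p + ennreal_powr (\<rho>A x) p) \<partial>lebesgue)"
    unfolding \<rho>_def
    by (intro nn_integral_mono order_trans[OF ennreal_powr_max_le] add_left_mono ennreal_powr_max_le)
  also have "\<dots> = (\<integral>\<^sup>+ x. ennreal_powr (\<rho>1 x) p \<partial>lebesgue) +
      ((\<integral>\<^sup>+ x. ennreal_powr (\<rho>0 x) p \<partial>lebesgue) + (\<integral>\<^sup>+ x. ennreal_powr (\<rho>A x) p \<partial>lebesgue))"
  proof -
    have m: "(\<lambda>x. ennreal_powr (g x) p) \<in> borel_measurable lebesgue" if "g \<in> borel_measurable borel" for g :: "real^'n \<Rightarrow> ennreal"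
      using measurable_compose[OF that borel_measurable_ennreal_powr] by (intro measurable_completion) simp
    show ?thesis using m[OF \<rho>1] m[OF \<rho>0] m[OF \<rho>Am] by (simp add: nn_integral_add)
  qed
  also have "(\<integral>\<^sup>+ x. ennreal_powr (\<rho>0 x) p \<partial>lebesgue) = 0"
  proof -
    have "(\<integral>\<^sup>+ x. ennreal_powr (\<rho>0 x) p \<partial>lebesgue) = (\<integral>\<^sup>+ x. \<infinity> * indicator N0 x \<partial>lebesgue)"
      by (intro nn_integral_cong) (auto simp: \<rho>0_def indicator_def ennreal_powr_def)
    also have "\<dots> = \<infinity> * emeasure lebesgue N0" using N0b by (intro nn_integral_cmult_indicator) auto
    also have "\<dots> = 0" using N0(1) N0b by (simp add: null_sets_def)
    finally show ?thesis .
  qed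
  also have "(\<integral>\<^sup>+ x. ennreal_powr (\<rho>1 x) p \<partial>lebesgue) \<le> ennreal ((1 + s) powr (p + 2)) * ?R"
    unfolding \<rho>1_def by (rule sum_nearly_linear_volume_le[OF D s p nl P PE E(2) Pdiff \<rho>s])
  finally show ?thesis using \<rho>A(2) by (simp add: add_mono less_imp_le add_left_mono order_trans)
qed

theorem theorem3p1:
  fixes f :: "real^'n \<Rightarrow> real^'n" and D E :: "(real^'n) set" and p :: real
    and \<Gamma> :: "('k::finite, 'n::finite) surface set" and \<rho>s :: "real^'n \<Rightarrow> ennreal"
  assumes "CARD('n) \<ge> 2" and "1 \<le> CARD('k)" and "CARD('k) \<le> CARD('n) - 1"
    and "p \<ge> real CARD('k)"
    and "open D" and "connected D" and "D \<noteq> {}"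
    and "continuous_on D f"
    and "orientation_preserving D f"
    and "finite_metric_distortion D f"
    and "A_property TYPE('k) p D f"
    and "E \<in> sets borel" and "E \<subseteq> D"
    and "\<Gamma> \<subseteq> surfaces_in E"
    and "\<rho>s \<in> admissible (surface_comp f ` \<Gamma>)"
  shows "modulus p \<Gamma> \<le>
    (\<integral>\<^sup>+ y\<in>f ` E. (inner_dilatation_inverse p f E y * ennreal_powr (\<rho>s y) p) \<partial>lebesgue)"
proof (cases "(\<integral>\<^sup>+ y\<in>f ` E. (inner_dilatation_inverse p f E y * ennreal_powr (\<rho>s y) p) \<partial>lebesgue)")
  case (real r)
  have p: "p > 0" using assms(2,4) by linarith
  have "modulus p \<Gamma> \<le> ennreal ((1 + s) powr (p + 2) * r + s)" if s: "s > 0" for s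
  proof -
    have "modulus p \<Gamma> \<le> ennreal ((1 + s) powr (p + 2)) * ennreal r + ennreal s"
      using modulus_le_of_finite[OF p assms(5,8,10,11,12,13,14,15) _ s] real by simp
    then show ?thesis using real s by (simp add: ennreal_mult)
  qed
  \<comment> \<open>The modulus does not depend on \<open>s\<close>, and finiteness of
    \<open>r\<close> makes the bound continuous at 0, where its value is \<open>r\<close>.\<close>
  moreover have "((\<lambda>s. ennreal ((1 + s) powr (p + 2) * r + s)) \<longlongrightarrow> ennreal ((1 + 0) powr (p + 2) * r + 0)) (at_right 0)"
    by (intro tendsto_intros tendsto_powr) auto
  ultimately have "modulus p \<Gamma> \<le> ennreal ((1 + 0) powr (p + 2) * r + 0)"
    by (intro tendsto_lowerbound[where F = "at_right 0"]) (auto intro: eventually_at_right_less eventually_mono)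
  then show ?thesis using real by simp
qed simp

end
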